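(* Assume the Continuum Hypothesis. There are sets $X,Y\subseteq\mathbb{R}$, each satisfying $\binom{\mathrm{B}_\Omega}{\mathrm{B}_\Gamma}$, such that the product space $X\times Y$ does not satisfy $\mathsf{S}_{\mathrm{fin}}(\mathrm{O},\mathrm{O})$ (Menger's property).
   Context: A cover of a space $X$ is a family $\mathcal U$ with $X=\bigcup\mathcal U$ such that $X$ is not contained in any single member. $\mathrm{O}(X)$ is the family of open covers of $X$. $\mathrm{B}_\Omega(X)$ is the family of countable Borel covers $\mathcal U$ of $X$ such that every finite subset of $X$ is contained in some member ($\omega$-covers); $\mathrm{B}_\Gamma(X)$ is the family of countable Borel covers that are infinite and such that every point of $X$ lies in all but finitely many members ($\gamma$-covers). $X$ satisfies $\binom{\mathrm{B}_\Omega}{\mathrm{B}_\Gamma}$ if every member of $\mathrm{B}_\Omega(X)$ contains a member of $\mathrm{B}_\Gamma(X)$. $X$ satisfies $\mathsf{S}_{\mathrm{fin}}(\mathrm O,\mathrm O)$ if for every sequence $(\mathcal U_n)_{n\in\mathbb N}$ of open covers of $X$ there are finite $\mathcal F_n\subseteq\mathcal U_n$ with $\bigcup_n\mathcal F_n$ an open cover of $X$. *)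

theory Defs
  imports "HOL-Analysis.Analysis"
begin

unbundle cardinal_syntax

definition continuum_hypothesis :: bool where
  "continuum_hypothesis \<longleftrightarrow> |UNIV :: real set| =o cardSuc natLeq"

text \<open>
  Covers are proper: the whole space is not contained in a single member. This also applies to
  \<open>\<omega>\<close>-covers and \<open>\<gamma>\<close>-covers.
\<close>

definition is_cover :: "'a topology \<Rightarrow> 'a set set \<Rightarrow> bool" where
  "is_cover T \<U> \<longleftrightarrow> topspace T = \<Union>\<U> \<and> (\<forall>U\<in>\<U>. \<not> topspace T \<subseteq> U)"

definition borel_sets_of :: "'a topology \<Rightarrow> 'a set set" where
  "borel_sets_of T = sigma_sets (topspace T) {U. openin T U}"

definition open_covers :: "'a topology \<Rightarrow> 'a set set set" where
  "open_covers T = {\<U>. is_cover T \<U> \<and> (\<forall>U\<in>\<U>. openin T U)}"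

definition countable_borel_covers :: "'a topology \<Rightarrow> 'a set set set" where
  "countable_borel_covers T = {\<U>. is_cover T \<U> \<and> countable \<U> \<and> \<U> \<subseteq> borel_sets_of T}"

definition borel_omega_covers :: "'a topology \<Rightarrow> 'a set set set" where
  "borel_omega_covers T =
     {\<U> \<in> countable_borel_covers T. \<forall>F. finite F \<and> F \<subseteq> topspace T \<longrightarrow> (\<exists>U\<in>\<U>. F \<subseteq> U)}"

definition borel_gamma_covers :: "'a topology \<Rightarrow> 'a set set set" where
  "borel_gamma_covers T =
     {\<U> \<in> countable_borel_covers T. infinite \<U> \<and> (\<forall>x\<in>topspace T. finite {U\<in>\<U>. x \<notin> U})}"

text \<open>The property \<open>(\<A> choose \<B>)\<close> and the selection principle \<open>S\<^sub>f\<^sub>i\<^sub>n(\<A>, \<B>)\<close>.\<close>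

definition choose_property :: "'a set set set \<Rightarrow> 'a set set set \<Rightarrow> bool" where
  "choose_property \<A> \<B> \<longleftrightarrow> (\<forall>\<U>\<in>\<A>. \<exists>\<V>. \<V> \<subseteq> \<U> \<and> \<V> \<in> \<B>)"

definition S_fin :: "'a set set set \<Rightarrow> 'a set set set \<Rightarrow> bool" where
  "S_fin \<A> \<B> \<longleftrightarrow>
     (\<forall>\<U> :: nat \<Rightarrow> 'a set set. (\<forall>n. \<U> n \<in> \<A>) \<longrightarrow>
        (\<exists>\<F>. (\<forall>n. finite (\<F> n) \<and> \<F> n \<subseteq> \<U> n) \<and> (\<Union>n. \<F> n) \<in> \<B>))"

end

theory Submission
  imports Defs
begin

text \<open>
  A Silver condition is an interval \<open>[a, b]\<close> of sets of natural numbers with \<open>b - a\<close> infinite. Read modulo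
  finite sets, these conditions are \<open>\<sigma>\<close>-closed. By a fusion argument every Borel set becomes clopen on a
  smaller condition; once all members of a countable Borel \<open>\<omega>\<close>-cover are clopen, the condition can be
  shrunk further so that a subsequence of the cover is eventually correct at every point of the condition.

  Under the Continuum Hypothesis this yields a tower of conditions \<open>[p\<^sub>t, q\<^sub>t]\<close> of length \<open>\<omega>\<^sub>1\<close>, together
  with points \<open>z\<^sub>t \<subseteq> p\<^sub>t \<subseteq> q\<^sub>t \<subseteq> x\<^sub>t\<close>, in which every Borel cover and every function \<open>g\<close> is treated at some
  stage. Take \<open>X\<close> and \<open>Z\<close> to be the finite modifications of the \<open>x\<^sub>t\<close> and of the \<open>z\<^sub>t\<close>. Points added later
  lie in the condition of the current stage, so the chosen subsequences are \<open>\<gamma>\<close>-covers of the final sets.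
  The difference \<open>x - z\<close> is infinite for all \<open>x \<in> X\<close> and \<open>z \<in> Z\<close>, but \<open>x\<^sub>t - z\<^sub>t\<close> is chosen sparser than \<open>g\<close>;
  hence the continuous map that enumerates \<open>x - z\<close> has a dominating image and \<open>X \<times> Z\<close> is not Menger.
  The sets are moved to the real line by the usual embedding of the Cantor space.
\<close>

subsection \<open>Silver conditions and Borel sets\<close>

text \<open>A Silver condition: \<open>a\<close> is the set of coordinates fixed to be in, the complement of \<open>b\<close> is
  the set of coordinates fixed to be out, and the infinitely many coordinates in \<open>b - a\<close> are free.\<close>
definition silver :: "nat set \<Rightarrow> nat set \<Rightarrow> bool" where
  "silver a b \<longleftrightarrow> a \<subseteq> b \<and> infinite (b - a)"

definition thins :: "nat set \<Rightarrow> nat set \<Rightarrow> nat set \<Rightarrow> nat set \<Rightarrow> bool" where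
  "thins a b a' b' \<longleftrightarrow> a \<subseteq> a' \<and> b' \<subseteq> b \<and> silver a' b'"

text \<open>Coordinates below \<open>k\<close> are unrestricted, so these sets increase with
  \<open>k\<close>; their union over all \<open>k\<close> is
  \<open>almost_between a b\<close>.\<close>

definition cube :: "nat set \<Rightarrow> nat set \<Rightarrow> nat \<Rightarrow> nat set set" where
  "cube a b k = {x. \<forall>i\<ge>k. (i \<in> a \<longrightarrow> i \<in> x) \<and> (i \<in> x \<longrightarrow> i \<in> b)}"

definition almost_between :: "nat set \<Rightarrow> nat set \<Rightarrow> nat set set" where
  "almost_between a b = {x. finite (a - x) \<and> finite (x - b)}"

lemma thins_refl: "silver a b \<Longrightarrow> thins a b a b"
  by (simp add: thins_def)

lemma thins_trans: "thins a b a' b' \<Longrightarrow> thins a' b' a'' b'' \<Longrightarrow> thins a b a'' b''"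
  by (auto simp: thins_def)

lemma thins_silver: "thins a b a' b' \<Longrightarrow> silver a' b'"
  by (simp add: thins_def)

lemma cube_mono: "a \<subseteq> a' \<Longrightarrow> b' \<subseteq> b \<Longrightarrow> k \<le> k' \<Longrightarrow> cube a' b' k \<subseteq> cube a b k'"
  by (force simp: cube_def)

lemma cube_le: "k \<le> k' \<Longrightarrow> cube a b k \<subseteq> cube a b k'"
  by (rule cube_mono) auto

lemma thins_cube: "thins a b a' b' \<Longrightarrow> cube a' b' k \<subseteq> cube a b k"
  by (rule cube_mono) (auto simp: thins_def)

lemma almost_between_mono:
  assumes "finite (a - a')" "finite (b' - b)"
  shows "almost_between a' b' \<subseteq> almost_between a b"
proof
  fix x assume "x \<in> almost_between a' b'"
  then have "finite (a' - x)" "finite (x - b')" by (auto simp: almost_between_def)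
  then have "finite ((a - a') \<union> (a' - x))" "finite ((x - b') \<union> (b' - b))" using assms by auto
  moreover have "a - x \<subseteq> (a - a') \<union> (a' - x)" "x - b \<subseteq> (x - b') \<union> (b' - b)" by auto
  ultimately show "x \<in> almost_between a b"
    unfolding almost_between_def mem_Collect_eq using finite_subset by metis
qed

lemma almost_between_imp_cube:
  assumes "x \<in> almost_between a b"
  shows "\<exists>k. x \<in> cube a b k"
proof -
  have "finite ((a - x) \<union> (x - b))" using assms by (auto simp: almost_between_def)
  then obtain k where "\<forall>i\<in>(a - x) \<union> (x - b). i < k"
    by (metis finite_nat_set_iff_bounded)
  then have "x \<in> cube a b k" unfolding cube_def mem_Collect_eq by (meson DiffI UnCI leD)
  then show ?thesis ..
qed

section \<open>Fusion of Silver conditions\<close>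

text \<open>Each round keeps the free coordinates below the current bound and then raises the bound
  past one more of them. So the union of the lower ends and the intersection of the upper ends still
  leave infinitely many coordinates free, and \<open>hered\<close> carries each
  \<open>\<Phi> n (\<kappa> n)\<close> to this limit.\<close>

lemma fusion:
  fixes \<Phi> :: "nat \<Rightarrow> nat \<Rightarrow> nat set \<Rightarrow> nat set \<Rightarrow> bool"
  assumes ab: "silver a b"
    and step: "\<And>n k a b. silver a b \<Longrightarrow>
      \<exists>a' b'. thins a b a' b' \<and> (b - a) \<inter> {..<k} \<subseteq> b' - a' \<and> \<Phi> n k a' b'"
    and hered: "\<And>n k a b a' b'. \<Phi> n k a b \<Longrightarrow> thins a b a' b' \<Longrightarrow> \<Phi> n k a' b'"
  shows "\<exists>a' b' \<kappa>. thins a b a' b' \<and> strict_mono \<kappa> \<and> k0 \<le> \<kappa> 0 \<and> (\<forall>n. \<Phi> n (\<kappa> n) a' b')"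
proof -
  define P where "P = (\<lambda>n (p::nat set \<times> nat set \<times> nat). case p of (c,d,k) \<Rightarrow>
      thins a b c d \<and> k0 \<le> k \<and> \<Phi> n k c d)"
  define Q where "Q = (\<lambda>(n::nat) (p::nat set \<times> nat set \<times> nat) (p'::nat set \<times> nat set \<times> nat).
      case p of (c,d,k) \<Rightarrow> case p' of (c',d',k') \<Rightarrow>
      thins c d c' d' \<and> k < k' \<and> (\<exists>i\<ge>k. i < k' \<and> i \<in> d - c) \<and> (d - c) \<inter> {..<k'} \<subseteq> d' - c')"
  have "\<exists>f. \<forall>n. P n (f n) \<and> Q n (f n) (f (Suc n))"
  proof (rule dependent_nat_choice)
    obtain a' b' where "thins a b a' b'" "\<Phi> 0 k0 a' b'" using step[OF ab] by blast
    then show "\<exists>p. P 0 p" by (intro exI[of _ "(a', b', k0)"]) (simp add: P_def)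
  next
    fix p n assume "P n p"
    then obtain c d k where p: "p = (c,d,k)" and cd: "thins a b c d" "k0 \<le> k" "\<Phi> n k c d"
      by (cases p) (auto simp: P_def)
    have "infinite (d - c)" using cd by (simp add: thins_def silver_def)
    then obtain i where i: "i \<ge> k" "i \<in> d - c" by (metis infinite_nat_iff_unbounded_le)
    \<comment> \<open>The bound \<open>Suc i\<close> instead of \<open>i\<close> protects the free
      coordinate \<open>i\<close> itself.\<close>
    obtain c' d' where c': "thins c d c' d'" "(d - c) \<inter> {..<Suc i} \<subseteq> d' - c'" "\<Phi> (Suc n) (Suc i) c' d'"
      using step[OF thins_silver[OF cd(1)]] by blast
    have "P (Suc n) (c', d', Suc i)" "Q n p (c', d', Suc i)"
      using c' i cd thins_trans by (auto simp: P_def Q_def p)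
    then show "\<exists>y. P (Suc n) y \<and> Q n p y" by blast
  qed
  then obtain f where f: "\<And>n. P n (f n)" "\<And>n. Q n (f n) (f (Suc n))" by blast
  define A where "A n = fst (f n)" for n
  define B where "B n = fst (snd (f n))" for n
  define \<kappa> where "\<kappa> n = snd (snd (f n))" for n
  have fn: "f n = (A n, B n, \<kappa> n)" for n by (simp add: A_def B_def \<kappa>_def)
  have 1: "thins a b (A n) (B n)" "k0 \<le> \<kappa> n" "\<Phi> n (\<kappa> n) (A n) (B n)" for n
    using f(1)[of n] by (auto simp: fn P_def)
  have 2: "thins (A n) (B n) (A (Suc n)) (B (Suc n))" "\<kappa> n < \<kappa> (Suc n)"
    "\<exists>i\<ge>\<kappa> n. i < \<kappa> (Suc n) \<and> i \<in> B n - A n"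
    "(B n - A n) \<inter> {..<\<kappa> (Suc n)} \<subseteq> B (Suc n) - A (Suc n)" for n
    using f(2)[of n] by (auto simp: fn Q_def)
  have sm: "strict_mono \<kappa>" using 2(2) by (simp add: strict_mono_Suc_iff)
  have mA: "mono A" using 2(1) by (auto simp: mono_iff_le_Suc thins_def)
  have mB: "antimono B" using 2(1) by (auto simp: antimono_iff_le_Suc thins_def)
  define a' where "a' = (\<Union>n. A n)"
  define b' where "b' = (\<Inter>n. B n)"
  have AB: "A m \<subseteq> B n" for m n
  proof -
    have "A m \<subseteq> A (max m n)" "B (max m n) \<subseteq> B n" using mA mB by (auto simp: mono_def antimono_def)
    moreover have "A (max m n) \<subseteq> B (max m n)" using 1(1) by (simp add: thins_def silver_def)
    ultimately show ?thesis by blast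
  qed
  have inf: "infinite (b' - a')"
    unfolding infinite_nat_iff_unbounded_le
  proof
    fix N
    obtain i where i: "i \<ge> \<kappa> N" "i < \<kappa> (Suc N)" "i \<in> B N - A N" using 2(3) by blast
    have up: "i \<in> B (N + m) - A (N + m)" for m
    proof (induction m)
      case (Suc m)
      have "\<kappa> (Suc N) \<le> \<kappa> (Suc (N + m))" using sm by (simp add: strict_mono_less_eq)
      then show ?case using Suc 2(4)[of "N + m"] i by auto
    qed (use i in auto)
    have "i \<in> B n - A n" for n
    proof -
      have "n \<le> N + n" by simp
      then have "A n \<subseteq> A (N + n)" "B (N + n) \<subseteq> B n" using mA mB by (auto simp only: mono_def antimono_def)
      then show ?thesis using up[of n] by blast
    qed
    then have "i \<in> b' - a'" by (simp add: a'_def b'_def)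
    moreover have "N \<le> i" using i sm strict_mono_imp_increasing[of \<kappa> N] by linarith
    ultimately show "\<exists>n\<ge>N. n \<in> b' - a'" by blast
  qed
  have th: "thins (A n) (B n) a' b'" for n
    using inf AB by (auto simp: thins_def silver_def a'_def b'_def)
  then have "\<Phi> n (\<kappa> n) a' b'" for n using hered 1(3) by blast
  moreover have "thins a b a' b'" using thins_trans[OF 1(1)[of 0] th] .
  ultimately show ?thesis using sm 1(2) by blast
qed

section \<open>Sets decided by finitely many coordinates\<close>

definition agree :: "nat \<Rightarrow> nat set \<Rightarrow> nat set \<Rightarrow> bool" where
  "agree k x y \<longleftrightarrow> (\<forall>i<k. i \<in> x \<longleftrightarrow> i \<in> y)"

lemma agree_sym: "agree k x y \<Longrightarrow> agree k y x"
  by (simp add: agree_def)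

text \<open>On the cube \<open>B\<close> depends only on the trace below \<open>k\<close>, so it is
  relatively clopen there. One implication is enough because \<open>x\<close> and \<open>y\<close>
  may be exchanged.\<close>

definition decides :: "nat set set \<Rightarrow> nat \<Rightarrow> nat set \<Rightarrow> nat set \<Rightarrow> bool" where
  "decides B k a b \<longleftrightarrow> (\<forall>x\<in>cube a b k. \<forall>y\<in>cube a b k. agree k x y \<longrightarrow> x \<in> B \<longrightarrow> y \<in> B)"

lemma decidesI: "(\<And>x y. x \<in> cube a b k \<Longrightarrow> y \<in> cube a b k \<Longrightarrow> agree k x y \<Longrightarrow> x \<in> B \<Longrightarrow> y \<in> B) \<Longrightarrow> decides B k a b"
  by (simp add: decides_def)

lemma decidesD: "decides B k a b \<Longrightarrow> x \<in> cube a b k \<Longrightarrow> y \<in> cube a b k \<Longrightarrow> agree k x y \<Longrightarrow> x \<in> B \<Longrightarrow> y \<in> B"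
  unfolding decides_def by meson

lemma decides_thins:
  assumes "decides B k a b" "thins a b a' b'"
  shows "decides B k a' b'"
proof (rule decidesI)
  fix x y assume "x \<in> cube a' b' k" "y \<in> cube a' b' k" "agree k x y" "x \<in> B"
  then show "y \<in> B" using decidesD[OF assms(1)] subsetD[OF thins_cube[OF assms(2)]] by metis
qed

text \<open>The level \<open>k\<close> is prescribed before the thinning, as the rounds of a fusion
  require.\<close>

definition decidable :: "nat set set \<Rightarrow> bool" where
  "decidable B \<longleftrightarrow> (\<forall>k a b. silver a b \<longrightarrow> (\<exists>a' b'. thins a b a' b' \<and> decides B k a' b'))"

lemma infinite_minus_lessThan: "infinite A \<Longrightarrow> infinite (A - {..<k::nat})"
  by (simp add: Diff_infinite_finite)

text \<open>\<open>decides B k\<close> sees the ends of a condition only from \<open>k\<close> on.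
  Below \<open>k\<close> the old ends can be restored, which keeps the free coordinates there, as
  \<open>fusion\<close> demands.\<close>

lemma decidable_stem:
  assumes "decidable B" "silver a b"
  shows "\<exists>a' b'. thins a b a' b' \<and> (b - a) \<inter> {..<k} \<subseteq> b' - a' \<and> decides B k a' b'"
proof -
  obtain a' b' where t: "thins a b a' b'" "decides B k a' b'"
    using assms unfolding decidable_def by blast
  define c where "c = (a \<inter> {..<k}) \<union> (a' - {..<k})"
  define d where "d = (b \<inter> {..<k}) \<union> (b' - {..<k})"
  have "infinite (b' - a' - {..<k})" using t by (intro infinite_minus_lessThan) (simp add: thins_def silver_def)
  moreover have "b' - a' - {..<k} \<subseteq> d - c" by (auto simp: c_def d_def)
  ultimately have "infinite (d - c)" using finite_subset by blast
  then have "thins a b c d" using t(1) assms(2) by (auto simp: c_def d_def thins_def silver_def)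
  moreover have "cube c d k = cube a' b' k"
    unfolding cube_def c_def d_def by (rule Collect_cong) auto
  then have "decides B k c d" using t(2) by (simp only: decides_def)
  moreover have "(b - a) \<inter> {..<k} \<subseteq> d - c" by (auto simp: c_def d_def)
  ultimately show ?thesis by blast
qed

text \<open>Together with \<open>freeze_upper\<close> this fixes the coordinates in
  \<open>{k..<m}\<close> as they are in \<open>x\<close>, spending only finitely many free
  coordinates.\<close>

definition freeze_lower :: "nat set \<Rightarrow> nat set \<Rightarrow> nat \<Rightarrow> nat \<Rightarrow> nat set" where
  "freeze_lower a x k m = a \<union> (x \<inter> {k..<m})"

definition freeze_upper :: "nat set \<Rightarrow> nat set \<Rightarrow> nat \<Rightarrow> nat \<Rightarrow> nat set" where
  "freeze_upper b x k m = b - ({k..<m} - x)"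

lemma thins_freeze:
  assumes "silver a b" "x \<in> cube a b k"
  shows "thins a b (freeze_lower a x k m) (freeze_upper b x k m)"
proof -
  have "infinite (b - a - {..<m})" using assms by (intro infinite_minus_lessThan) (simp add: silver_def)
  moreover have "b - a - {..<m} \<subseteq> freeze_upper b x k m - freeze_lower a x k m"
    by (auto simp: freeze_lower_def freeze_upper_def)
  ultimately have "infinite (freeze_upper b x k m - freeze_lower a x k m)" using finite_subset by blast
  moreover have "freeze_lower a x k m \<subseteq> freeze_upper b x k m"
    using assms by (auto simp: freeze_lower_def freeze_upper_def cube_def silver_def)
  ultimately show ?thesis
    by (auto simp: thins_def silver_def freeze_lower_def freeze_upper_def)
qed

lemma freeze_agree:
  assumes y: "y \<in> cube (freeze_lower a x k m) (freeze_upper b x k m) k"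
    and "z \<in> cube (freeze_lower a x k m) (freeze_upper b x k m) k" "agree k y z"
  shows "agree m y z"
proof -
  have *: "i \<in> w \<longleftrightarrow> i \<in> x" if "w \<in> cube (freeze_lower a x k m) (freeze_upper b x k m) k" "k \<le> i" "i < m" for w i
  proof (cases "i \<in> x")
    case True
    then have "i \<in> freeze_lower a x k m" using that by (simp add: freeze_lower_def)
    then show ?thesis using True that(1,2) by (simp add: cube_def)
  next
    case False
    then have "i \<notin> freeze_upper b x k m" using that by (simp add: freeze_upper_def)
    then show ?thesis using False that(1,2) unfolding cube_def by blast
  qed
  show ?thesis
    unfolding agree_def
  proof (intro allI impI)
    fix i assume "i < m"
    then show "i \<in> y \<longleftrightarrow> i \<in> z"
      using *[OF y] *[OF assms(2)] assms(3) unfolding agree_def by (cases "i < k") simp_all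
  qed
qed

lemma cube_freeze:
  assumes "x \<in> cube a b k"
  shows "x \<in> cube (freeze_lower a x k m) (freeze_upper b x k m) k"
  using assms by (auto simp: cube_def freeze_lower_def freeze_upper_def)

lemma decidable_finite_support:
  assumes "\<And>x y. agree m x y \<Longrightarrow> x \<in> B \<Longrightarrow> y \<in> B"
  shows "decidable B"
  unfolding decidable_def
proof (intro allI impI)
  fix k a b assume ab: "silver a b"
  then have a: "a \<in> cube a b k" by (auto simp: silver_def cube_def)
  have "decides B k (freeze_lower a a k m) (freeze_upper b a k m)"
    by (rule decidesI) (rule assms[OF freeze_agree])
  with thins_freeze[OF ab a] show "\<exists>a' b'. thins a b a' b' \<and> decides B k a' b'" by metis
qed

text \<open>Each of the finitely many traces below \<open>k\<close> is decided in turn, at the cost of freezing finitely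
  many free coordinates.\<close>
lemma decidable_open:
  assumes ab: "silver a b"
    and op: "\<And>x. x \<in> cube a b k \<Longrightarrow> x \<in> U \<Longrightarrow> \<exists>m. \<forall>y\<in>cube a b k. agree m x y \<longrightarrow> y \<in> U"
  shows "\<exists>a' b'. thins a b a' b' \<and> decides U k a' b'"
proof -
  define D where "D = (\<lambda>s a' b'. (\<forall>y\<in>cube a' b' k. agree k s y \<longrightarrow> y \<in> U) \<or>
    (\<forall>y\<in>cube a' b' k. agree k s y \<longrightarrow> y \<notin> U))"
  have D_thins: "D s a' b'" if "D s c d" "thins c d a' b'" for s a' b' c d
    using that(1) subsetD[OF thins_cube[OF that(2)]] unfolding D_def by meson
  have "\<exists>a' b'. thins a b a' b' \<and> (\<forall>s\<in>S. D s a' b')" if "finite S" for S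
    using that
  proof (induction S rule: finite_induct)
    case empty then show ?case using thins_refl[OF ab] by blast
  next
    case (insert s S)
    then obtain c d where cd: "thins a b c d" "\<forall>s\<in>S. D s c d" by auto
    have "\<exists>c' d'. thins c d c' d' \<and> D s c' d'"
    proof (cases "\<exists>x\<in>cube c d k. agree k s x \<and> x \<in> U")
      case True
      then obtain x where x: "x \<in> cube c d k" "agree k s x" "x \<in> U" by blast
      have "x \<in> cube a b k" using subsetD[OF thins_cube[OF cd(1)] x(1)] .
      then obtain m where m: "\<forall>y\<in>cube a b k. agree m x y \<longrightarrow> y \<in> U"
        using op x(3) by meson
      let ?c = "freeze_lower c x k m" and ?d = "freeze_upper d x k m"
      have t: "thins c d ?c ?d" using thins_freeze[OF thins_silver[OF cd(1)] x(1)] .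
      have "y \<in> U" if "y \<in> cube ?c ?d k" "agree k s y" for y
      proof (rule m[rule_format])
        show "y \<in> cube a b k" using that(1) by (rule subsetD[OF thins_cube[OF thins_trans[OF cd(1) t]]])
        have "agree k x y" using x(2) that(2) by (simp add: agree_def)
        then show "agree m x y" by (rule freeze_agree[OF cube_freeze[OF x(1)] that(1)])
      qed
      then have "D s ?c ?d" by (simp add: D_def)
      then show ?thesis using t by blast
    next
      case False
      then have "D s c d" unfolding D_def by blast
      then show ?thesis using thins_refl[OF thins_silver[OF cd(1)]] by blast
    qed
    then obtain c' d' where c': "thins c d c' d'" "D s c' d'" by blast
    have "\<forall>t\<in>S. D t c' d'" using cd(2) D_thins c'(1) by meson
    then show ?case using c' thins_trans[OF cd(1)] by blast
  qed
  from this[of "Pow {..<k}"] obtain a' b' where t: "thins a b a' b'" "\<forall>s\<in>Pow {..<k}. D s a' b'"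
    by auto
  have "decides U k a' b'"
  proof (rule decidesI)
    fix x y assume xy: "x \<in> cube a' b' k" "y \<in> cube a' b' k" "agree k x y" "x \<in> U"
    have "D (x \<inter> {..<k}) a' b'" using t by blast
    moreover have "agree k (x \<inter> {..<k}) x" "agree k (x \<inter> {..<k}) y" using xy(3) by (auto simp: agree_def)
    ultimately show "y \<in> U" using xy unfolding D_def by meson
  qed
  then show ?thesis using t by blast
qed

text \<open>A fusion decides each \<open>B n\<close> at its own level
  \<open>\<kappa> n \<ge> k\<close>. The union is then relatively open on the cube at level
  \<open>k\<close>, and \<open>decidable_open\<close> decides it at level \<open>k\<close>.\<close>

lemma decidable_UN:
  fixes B :: "nat \<Rightarrow> nat set set"
  assumes "\<And>n. decidable (B n)"
  shows "decidable (\<Union>n. B n)"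
  unfolding decidable_def
proof (intro allI impI)
  fix k a b assume ab: "silver a b"
  have "\<exists>a' b' \<kappa>. thins a b a' b' \<and> strict_mono \<kappa> \<and> k \<le> \<kappa> 0 \<and> (\<forall>n. decides (B n) (\<kappa> n) a' b')"
    by (rule fusion[where \<Phi> = "\<lambda>n. decides (B n)", OF ab decidable_stem[OF assms] decides_thins])
  then obtain a' b' \<kappa> where f: "thins a b a' b'" "strict_mono \<kappa>" "k \<le> \<kappa> 0"
    "\<And>n. decides (B n) (\<kappa> n) a' b'" by blast
  have k: "k \<le> \<kappa> n" for n using f(2,3) by (meson le0 order_trans strict_mono_less_eq)
  have "\<exists>a'' b''. thins a' b' a'' b'' \<and> decides (\<Union>n. B n) k a'' b''"
  proof (rule decidable_open[OF thins_silver[OF f(1)]])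
    fix x assume x: "x \<in> cube a' b' k" "x \<in> (\<Union>n. B n)"
    then obtain n where n: "x \<in> B n" by blast
    have "y \<in> B n" if "y \<in> cube a' b' k" "agree (\<kappa> n) x y" for y
      using decidesD[OF f(4) _ _ that(2) n] x(1) that(1) subsetD[OF cube_le[OF k]] by metis
    then show "\<exists>m. \<forall>y\<in>cube a' b' k. agree m x y \<longrightarrow> y \<in> (\<Union>n. B n)" by blast
  qed
  then show "\<exists>a' b'. thins a b a' b' \<and> decides (\<Union>n. B n) k a' b'" using thins_trans[OF f(1)] by blast
qed

lemma decidable_Compl:
  assumes "decidable B"
  shows "decidable (- B)"
proof -
  have "decides (- B) k a b" if "decides B k a b" for k a b
  proof (rule decidesI)
    fix x y assume "x \<in> cube a b k" "y \<in> cube a b k" "agree k x y" "x \<in> - B"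
    then show "y \<in> - B" using decidesD[OF that _ _ agree_sym] by (metis ComplD ComplI)
  qed
  then show ?thesis using assms unfolding decidable_def by meson
qed

text \<open>Round \<open>n\<close> of the fusion decides all \<open>B i\<close> with
  \<open>i < n\<close> at level \<open>\<kappa> n\<close>, so a single condition decides each set at
  arbitrarily high levels.\<close>

lemma decide_sequence:
  fixes B :: "nat \<Rightarrow> nat set set"
  assumes B: "\<And>n. decidable (B n)" and ab: "silver a b"
  shows "\<exists>a' b'. thins a b a' b' \<and> (\<forall>i k. \<exists>m\<ge>k. decides (B i) m a' b')"
proof -
  have step: "\<exists>a' b'. thins a b a' b' \<and> (b - a) \<inter> {..<k} \<subseteq> b' - a' \<and> (\<forall>i<n. decides (B i) k a' b')"
    if "silver a b" for n k a b
  proof (induction n)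
    case 0 then show ?case using thins_refl[OF that] by blast
  next
    case (Suc n)
    then obtain c d where c: "thins a b c d" "(b - a) \<inter> {..<k} \<subseteq> d - c" "\<forall>i<n. decides (B i) k c d" by blast
    obtain c' d' where c': "thins c d c' d'" "(d - c) \<inter> {..<k} \<subseteq> d' - c'" "decides (B n) k c' d'"
      using decidable_stem[OF B thins_silver[OF c(1)]] by blast
    have "\<forall>i<Suc n. decides (B i) k c' d'"
      using c(3) c'(3) decides_thins[OF _ c'(1)] by (simp add: less_Suc_eq)
    moreover have "(b - a) \<inter> {..<k} \<subseteq> d' - c'" using c(2) c'(2) by blast
    ultimately show ?case using thins_trans[OF c(1) c'(1)] by blast
  qed
  have "\<exists>a' b' \<kappa>. thins a b a' b' \<and> strict_mono \<kappa> \<and> 0 \<le> \<kappa> 0 \<and> (\<forall>n. \<forall>i<n. decides (B i) (\<kappa> n) a' b')"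
    by (rule fusion[where \<Phi> = "\<lambda>n k a b. \<forall>i<n. decides (B i) k a b", OF ab step])
      (assumption, meson decides_thins)
  then obtain a' b' \<kappa> where f: "thins a b a' b'" "strict_mono \<kappa>" "\<And>n i. i < n \<Longrightarrow> decides (B i) (\<kappa> n) a' b'" by blast
  have "\<exists>m\<ge>k. decides (B i) m a' b'" for i k
  proof (intro exI conjI)
    show "decides (B i) (\<kappa> (Suc (i + k))) a' b'" by (rule f) simp
    show "k \<le> \<kappa> (Suc (i + k))" using strict_mono_imp_increasing[OF f(2), of "Suc (i + k)"] by linarith
  qed
  then show ?thesis using f(1) by blast
qed

subsection \<open>One stage of the construction\<close>

lemma strict_mono_choice:
  fixes P :: "nat \<Rightarrow> nat \<Rightarrow> bool"
  assumes "\<And>n l. \<exists>c>l. P n c"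
  obtains c where "strict_mono c" "\<And>n. P n (c n)"
proof -
  have "\<forall>n l. \<exists>c. l < c \<and> P n c" using assms by blast
  then obtain f where f: "\<And>n l. f n l > l" "\<And>n l. P n (f n l)" by metis
  define c where "c = rec_nat (f 0 0) (\<lambda>n l. f (Suc n) l)"
  have "c n < c (Suc n)" for n by (simp add: c_def f)
  moreover have "P n (c n)" for n by (cases n) (simp_all add: c_def f)
  ultimately show thesis by (intro that[of c]) (auto simp: strict_mono_Suc_iff)
qed

text \<open>Choose increasing elements, the \<open>n\<close>-th (counted from \<open>0\<close>) at
  least \<open>g n\<close>; only the \<open>n\<close> earlier ones can lie below
  \<open>g n\<close>.\<close>

lemma infinite_sparse_subset:
  fixes C :: "nat set"
  assumes "infinite C"
  obtains D where "D \<subseteq> C" "infinite D" "\<And>n. card (D \<inter> {..<g n}) \<le> n"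
proof -
  have "\<exists>c>l. c \<in> C \<and> g n \<le> c" for n l
    using infinite_nat_iff_unbounded[THEN iffD1, OF assms, rule_format, of "max l (g n)"] by auto
  then obtain e where e: "strict_mono e" "\<And>n. e n \<in> C \<and> g n \<le> e n"
    by (rule strict_mono_choice[of "\<lambda>n c. c \<in> C \<and> g n \<le> c"]) blast
  have "card (range e \<inter> {..<g n}) \<le> n" for n
  proof -
    have "range e \<inter> {..<g n} \<subseteq> e ` {..<n}"
    proof clarsimp
      fix l assume "e l < g n"
      then have "e l < e n" using e(2)[of n] by linarith
      then show "e l \<in> e ` {..<n}" using e(1) by (simp add: strict_mono_less)
    qed
    then have "card (range e \<inter> {..<g n}) \<le> card (e ` {..<n})" by (simp add: card_mono)
    also have "\<dots> \<le> n" using card_image_le[of "{..<n}" e] by simp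
    finally show ?thesis .
  qed
  moreover have "infinite (range e)" using e(1) by (simp add: range_inj_infinite strict_mono_imp_inj_on)
  ultimately show thesis using that e(2) by blast
qed

lemma infinite_split_three:
  fixes C :: "nat set"
  assumes "infinite C"
  obtains D E where "D \<subseteq> C" "E \<subseteq> C" "D \<inter> E = {}" "infinite D" "infinite E" "infinite (C - D - E)"
proof -
  obtain S :: "nat \<Rightarrow> nat set" where S: "pairwise (\<lambda>i j. disjnt (S i) (S j)) UNIV"
      "(\<Union>i. S i) \<subseteq> C" "\<And>i. infinite (S i)"
    using infinite_infinite_partition[OF assms] by blast
  have disj: "S i \<inter> S j = {}" if "i \<noteq> j" for i j
    using S(1) that by (simp add: pairwise_def disjnt_def)
  have "S 2 \<inter> S 0 = {}" "S 2 \<inter> S 1 = {}" by (rule disj, simp)+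
  then have "S 2 \<subseteq> C - S 0 - S 1" using S(2) by blast
  then have "infinite (C - S 0 - S 1)" using S(3) finite_subset by metis
  then show thesis using that[of "S 0" "S 1"] S(2,3) disj[OF zero_neq_one] by blast
qed

lemma countable_almost_between: "countable (almost_between r r)"
proof -
  have "almost_between r r \<subseteq> (\<lambda>(F, G). (r - F) \<union> G) ` ({F. finite F} \<times> {G. finite G})"
  proof
    fix x assume "x \<in> almost_between r r"
    then have "finite (r - x)" "finite (x - r)" by (auto simp: almost_between_def)
    then show "x \<in> (\<lambda>(F, G). (r - F) \<union> G) ` ({F. finite F} \<times> {G. finite G})"
      by (intro image_eqI[of _ _ "(r - x, x - r)"]) auto
  qed
  then show ?thesis
    by (rule countable_subset) (intro countable_image countable_SIGMA countable_Collect_finite)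
qed

text \<open>This is \<open>\<sigma>\<close>-closure modulo finite sets. Common free coordinates
  \<open>c n\<close> of longer and longer initial parts of the family form the new free set, and the
  lower end collects tails of the sets \<open>a s\<close>.\<close>

lemma countable_lower_bound:
  fixes a b :: "'i \<Rightarrow> nat set"
  assumes "countable I"
    and fin: "\<And>s t. s \<in> I \<Longrightarrow> t \<in> I \<Longrightarrow> finite (a s - b t)"
    and inf: "\<And>F. finite F \<Longrightarrow> F \<subseteq> I \<Longrightarrow> infinite ((\<Inter>s\<in>F. b s) - (\<Union>s\<in>F. a s))"
  shows "\<exists>c d. silver c d \<and> (\<forall>s\<in>I. finite (a s - c) \<and> finite (d - b s))"
proof (cases "I = {}")
  case True
  then show ?thesis by (intro exI[of _ "{}"] exI[of _ UNIV]) (simp add: silver_def)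
next
  case False
  define e where "e = from_nat_into I"
  have e: "range e = I" using assms(1) False by (simp add: e_def)
  then have eI: "e n \<in> I" for n by auto
  define A where "A n = (\<Union>i\<le>n. a (e i))" for n
  define B where "B n = (\<Inter>i\<le>n. b (e i))" for n
  have "finite (A n - B n)" for n
  proof -
    have "A n - B n \<subseteq> (\<Union>i\<le>n. \<Union>j\<le>n. a (e i) - b (e j))" by (auto simp: A_def B_def)
    moreover have "finite (\<Union>i\<le>n. \<Union>j\<le>n. a (e i) - b (e j))" using fin eI by (intro finite_UN_I) auto
    ultimately show ?thesis by (rule finite_subset)
  qed
  then have "\<exists>m. \<forall>i\<in>A n - B n. i < m" for n by (simp add: finite_nat_set_iff_bounded)
  then obtain M where M: "\<And>n i. i \<in> A n - B n \<Longrightarrow> i < M n" by metis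
  have "infinite (B n - A n)" for n
    using inf[of "e ` {..n}"] eI by (auto simp: A_def B_def image_subset_iff)
  then have "\<exists>c>l. c \<in> B n - A n \<and> M n \<le> c" for n l
    using infinite_nat_iff_unbounded[THEN iffD1, rule_format, of "B n - A n" "max l (M n)"] by auto
  then obtain c where c: "strict_mono c" "\<And>n. c n \<in> B n - A n \<and> M n \<le> c n"
    by (rule strict_mono_choice[of "\<lambda>n c. c \<in> B n - A n \<and> M n \<le> c"]) blast
  \<comment> \<open>Cutting at \<open>c n\<close> keeps all chosen coordinates out of
    \<open>lo\<close>. As \<open>M n \<le> c n\<close>, elements of \<open>a (e n)\<close> above the
    cut lie in \<open>b (e i)\<close> for all \<open>i \<le> n\<close>.\<close>
  define lo where "lo = (\<Union>n. a (e n) - {..c n})"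
  have c_notin: "c n \<notin> a (e m) - {..c m}" for n m
  proof (cases "m \<le> n")
    case True
    then show ?thesis using c(2)[of n] by (auto simp: A_def)
  next
    case False
    then have "c n \<le> c m" using c(1) by (simp add: strict_mono_less_eq)
    then show ?thesis by simp
  qed
  have "infinite (range c)" using c(1) by (simp add: range_inj_infinite strict_mono_imp_inj_on)
  moreover have "range c \<subseteq> lo \<union> range c - lo" using c_notin by (auto simp: lo_def)
  ultimately have "silver lo (lo \<union> range c)" unfolding silver_def using finite_subset by blast
  moreover have "finite (a (e n) - lo) \<and> finite (lo \<union> range c - b (e n))" for n
  proof
    have "a (e n) - lo \<subseteq> {..c n}" by (auto simp: lo_def)
    then show "finite (a (e n) - lo)" by (rule finite_subset) simp
    have up: "x \<in> b (e n)" if "x \<in> B m" "n \<le> m" for x m using that by (auto simp: B_def)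
    have "lo \<union> range c - b (e n) \<subseteq> (\<Union>m<n. a (e m) - b (e n)) \<union> c ` {..<n}"
    proof
      fix x assume x: "x \<in> lo \<union> range c - b (e n)"
      show "x \<in> (\<Union>m<n. a (e m) - b (e n)) \<union> c ` {..<n}"
      proof (cases "x \<in> range c")
        case True
        then obtain m where m: "x = c m" by blast
        then have "m < n" using up[of x m] c(2)[of m] x by (auto simp: not_less[symmetric])
        then show ?thesis using m by blast
      next
        case False
        then obtain m where m: "x \<in> a (e m)" "x > c m" using x by (auto simp: lo_def)
        have "x \<in> B m"
        proof (rule ccontr)
          assume "x \<notin> B m"
          then have "x < M m" using M m(1) by (auto simp: A_def)
          then show False using c(2)[of m] m(2) by linarith
        qed
        then have "m < n" using up[of x m] x by (auto simp: not_less[symmetric])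
        then show ?thesis using m(1) x by blast
      qed
    qed
    then show "finite (lo \<union> range c - b (e n))"
      by (rule finite_subset) (use fin[OF eI eI] in \<open>simp only: finite_UN finite_Un finite_imageI finite_lessThan\<close>, blast)
  qed
  ultimately show ?thesis using e by blast
qed

text \<open>This is the property \<open>\<omega>\<close>-cover-contains-\<open>\<gamma>\<close>-cover, split so that it can be decided at a stage of the
  recursion: \<open>E\<close> holds the points constructed so far, \<open>R\<close> all points that may still appear.\<close>
definition selectable :: "(nat \<Rightarrow> nat set set) \<Rightarrow> nat set set \<Rightarrow> nat set set \<Rightarrow> bool" where
  "selectable B E R \<longleftrightarrow> ((\<forall>F. finite F \<longrightarrow> F \<subseteq> E \<longrightarrow> (\<exists>i. F \<subseteq> B i)) \<longrightarrow>
     (\<exists>i :: nat \<Rightarrow> nat. \<forall>x\<in>E \<union> R. \<exists>N. \<forall>n\<ge>N. x \<in> B (i n)))"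

lemma selectable_mono: "selectable B E R \<Longrightarrow> R' \<subseteq> R \<Longrightarrow> selectable B E R'"
  unfolding selectable_def by (meson UnE UnI1 UnI2 subsetD)

text \<open>A member of the cover that contains the finitely many points agreeing with \<open>r\<close> from \<open>k\<close> on contains,
  by \<open>B\<close>, the cube of points that agree with \<open>r\<close> merely on some \<open>{k..<m}\<close>. So it is enough that the free
  set \<open>C\<close> avoids these intervals.\<close>
lemma gamma_thinning:
  assumes ab: "silver a b" and B: "\<forall>i k. \<exists>m\<ge>k. decides (B i) m a b"
    and r: "a \<subseteq> r" "r \<subseteq> b" and E: "countable E" "almost_between r r \<subseteq> E"
  shows "\<exists>C\<subseteq>b - a. infinite C \<and> selectable B E (almost_between (r - C) (r \<union> C))"
proof (cases "\<forall>F. finite F \<longrightarrow> F \<subseteq> E \<longrightarrow> (\<exists>i. F \<subseteq> B i)")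
  case False
  then have "selectable B E R" for R by (simp only: selectable_def) blast
  then show ?thesis using ab by (intro exI[of _ "b - a"]) (simp add: silver_def)
next
  case True
  define e where "e = from_nat_into E"
  have "r \<in> E" using E(2) by (auto simp: almost_between_def)
  then have e: "range e = E" using E(1) unfolding e_def by (intro range_from_nat_into) auto
  \<comment> \<open>\<open>B i\<close> is to contain \<open>e 0\<close> up to \<open>e n\<close> and
    all points of the cube that agree with \<open>r\<close> on \<open>{k..<m}\<close>;
    \<open>c\<close> is the next element of the new free set, not before the end of this
    interval.\<close>
  define Q where "Q n k i m c \<longleftrightarrow> k \<le> m \<and> m \<le> c \<and> c \<in> b - a \<and> e ` {..n} \<subseteq> B i \<and>
      (\<forall>y\<in>cube a b k. (\<forall>j. k \<le> j \<longrightarrow> j < m \<longrightarrow> (j \<in> y \<longleftrightarrow> j \<in> r)) \<longrightarrow> y \<in> B i)"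
    for n k i m c
  have "\<exists>i m c. Q n k i m c" for n k
  proof -
    let ?F = "e ` {..n} \<union> (\<lambda>s. s \<union> (r - {..<k})) ` Pow {..<k}"
    have "s \<union> (r - {..<k}) \<in> E" if "s \<subseteq> {..<k}" for s
    proof (rule subsetD[OF E(2)])
      have "r - (s \<union> (r - {..<k})) \<subseteq> {..<k}" "s \<union> (r - {..<k}) - r \<subseteq> {..<k}" using that by auto
      then show "s \<union> (r - {..<k}) \<in> almost_between r r"
        unfolding almost_between_def by (intro CollectI conjI; elim finite_subset) simp_all
    qed
    then have "?F \<subseteq> E" using e by auto
    then obtain i where i: "?F \<subseteq> B i" using True by (meson finite_Un finite_Pow_iff finite_atMost finite_imageI finite_lessThan)
    obtain m where m: "m \<ge> k" "decides (B i) m a b" using B by blast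
    obtain c where c: "m \<le> c" "c \<in> b - a"
      using ab unfolding silver_def by (metis infinite_nat_iff_unbounded_le)
    have "y \<in> B i" if y: "y \<in> cube a b k" "\<forall>j. k \<le> j \<longrightarrow> j < m \<longrightarrow> (j \<in> y \<longleftrightarrow> j \<in> r)" for y
    proof -
      \<comment> \<open>This point agrees with \<open>r\<close> from \<open>k\<close> on, so
        \<open>B i\<close> was chosen to contain it; it agrees with \<open>y\<close> below
        \<open>m\<close>.\<close>
      let ?x = "(y \<inter> {..<k}) \<union> (r - {..<k})"
      have "?x \<in> cube a b m" using r m(1) by (auto simp: cube_def)
      moreover have "y \<in> cube a b m" using subsetD[OF cube_le[OF m(1)] y(1)] .
      moreover have "agree m ?x y" 
        unfolding agree_def
      proof (intro allI impI)
        fix j assume "j < m"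
        then show "j \<in> ?x \<longleftrightarrow> j \<in> y" using y(2) by (cases "j < k") simp_all
      qed
      moreover have "?x \<in> B i"
        by (rule subsetD[OF i], rule UnI2, rule imageI) simp
      ultimately show ?thesis using decidesD[OF m(2)] by meson
    qed
    then have "Q n k i m c" using i m(1) c unfolding Q_def by simp
    then show ?thesis by blast
  qed
  then obtain I M Cf where Q: "\<And>n k. Q n k (I n k) (M n k) (Cf n k)" by metis
  have *: "k \<le> M n k" "M n k \<le> Cf n k" "Cf n k \<in> b - a" "e ` {..n} \<subseteq> B (I n k)" for n k
    using Q[of n k] unfolding Q_def by simp_all
  have **: "y \<in> B (I n k)"
    if "y \<in> cube a b k" "\<And>j. k \<le> j \<Longrightarrow> j < M n k \<Longrightarrow> (j \<in> y \<longleftrightarrow> j \<in> r)" for n k y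
    using Q[of n k] that unfolding Q_def by simp
  \<comment> \<open>Block \<open>n\<close> starts at \<open>K n\<close>, right after the previously
    chosen element, and its own element is at least \<open>M n (K n)\<close>; hence \<open>C\<close>
    misses \<open>{K n..<M n (K n)}\<close>.\<close>
  define K where "K = rec_nat 0 (\<lambda>n k. Suc (Cf n k))"
  have K: "K (Suc n) = Suc (Cf n (K n))" for n by (simp add: K_def)
  define c where "c n = Cf n (K n)" for n
  have Kc: "K n \<le> c n" "c n < K (Suc n)" for n
    using *(1)[of "K n" n] *(2)[of n "K n"] by (auto simp: K c_def)
  then have sK: "strict_mono K" by (meson le_less_trans strict_mono_Suc_iff)
  have sc: "strict_mono c" using Kc by (meson less_le_trans strict_mono_Suc_iff)
  define C where "C = range c"
  have gap: "j \<notin> C" if "K n \<le> j" "j < M n (K n)" for j n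
  proof
    assume "j \<in> C"
    then obtain l where l: "j = c l" by (auto simp: C_def)
    show False
    proof (cases "l < n")
      case True
      then have "K (Suc l) \<le> K n" using sK by (simp add: strict_mono_less_eq)
      then show False using Kc(2)[of l] l that by linarith
    next
      case False
      then have "c n \<le> c l" using sc by (simp add: strict_mono_less_eq)
      then show False using *(2)[of n "K n"] l that by (simp add: c_def)
    qed
  qed
  have C: "C \<subseteq> b - a" "infinite C"
    using *(3) sc by (auto simp: C_def c_def[symmetric] range_inj_infinite strict_mono_imp_inj_on)
      (metis c_def *(3) DiffD1 DiffD2)+
  \<comment> \<open>Points of \<open>E\<close> are captured through the enumeration
    \<open>e\<close>, the others because they eventually agree with \<open>r\<close> on the gaps of
    \<open>C\<close>.\<close>
  have "\<exists>N. \<forall>n\<ge>N. x \<in> B (I n (K n))" if x: "x \<in> E \<union> almost_between (r - C) (r \<union> C)" for x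
  proof (cases "x \<in> E")
    case True
    then obtain l where l: "x = e l" using e by auto
    have "x \<in> B (I n (K n))" if "n \<ge> l" for n
      using *(4)[of n "K n"] that l by blast
    then show ?thesis by blast
  next
    case False
    then obtain k where k: "x \<in> cube (r - C) (r \<union> C) k" using x almost_between_imp_cube by blast
    have "x \<in> B (I n (K n))" if "n \<ge> k" for n
    proof (rule **)
      have kK: "k \<le> K n" using strict_mono_imp_increasing[OF sK, of n] that by linarith
      show "x \<in> cube a b (K n)" 
        unfolding cube_def
      proof (intro CollectI allI impI)
        fix i assume "K n \<le> i"
        then have i: "i \<in> r - C \<Longrightarrow> i \<in> x" "i \<in> x \<Longrightarrow> i \<in> r \<union> C" using k kK by (auto simp: cube_def)
        then show "(i \<in> a \<longrightarrow> i \<in> x) \<and> (i \<in> x \<longrightarrow> i \<in> b)" using r C(1) by blast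
      qed
      fix j assume j: "K n \<le> j" "j < M n (K n)"
      then have "j \<notin> C" by (rule gap)
      moreover have "j \<in> r - C \<Longrightarrow> j \<in> x" "j \<in> x \<Longrightarrow> j \<in> r \<union> C" using k kK j(1) by (auto simp: cube_def)
      ultimately show "j \<in> x \<longleftrightarrow> j \<in> r" by blast
    qed
    then show ?thesis by blast
  qed
  then have "\<forall>x\<in>E \<union> almost_between (r - C) (r \<union> C). \<exists>N. \<forall>n\<ge>N. x \<in> B (I n (K n))"
    by (intro ballI)
  then have "selectable B E (almost_between (r - C) (r \<union> C))"
    unfolding selectable_def by (intro impI exI[of _ "\<lambda>n. I n (K n)"])
  then show ?thesis using C by blast
qed

text \<open>The order of the choices matters: \<open>x\<close> is the upper end of the condition in which everything is
  decided, and \<open>z\<close> is the lower end of the condition obtained by thinning around \<open>x\<close>, so that both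
  may serve as centres of a thinning.\<close>
lemma successor_step:
  fixes B1 B2 :: "nat \<Rightarrow> nat set set"
  assumes ab: "silver a b" and dec: "\<And>i. decidable (B1 i)" "\<And>i. decidable (B2 i)"
    and cnt: "countable X0" "countable Z0"
  shows "\<exists>x z a' b'. a \<subseteq> z \<and> z \<subseteq> x \<and> x \<subseteq> b \<and> z \<subseteq> a' \<and> b' \<subseteq> x \<and> silver a' b' \<and>
    infinite (a' - z) \<and> infinite (x - b') \<and> (\<forall>n. card ((x - z) \<inter> {..<g n}) \<le> n) \<and>
    selectable B1 (X0 \<union> almost_between x x) (almost_between a' b') \<and>
    selectable B2 (Z0 \<union> almost_between z z) (almost_between a' b')"
proof -
  obtain a0 b0 where 0: "thins a b a0 b0" "\<forall>i k. \<exists>m\<ge>k. decides (B1 i) m a0 b0"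
    using decide_sequence[where B = B1, OF dec(1) ab] by blast
  obtain a1 b1 where 1: "thins a0 b0 a1 b1" "\<forall>i k. \<exists>m\<ge>k. decides (B2 i) m a1 b1"
    using decide_sequence[where B = B2, OF dec(2) thins_silver[OF 0(1)]] by blast
  \<comment> \<open>Only \<open>D\<close> stays free from here on, so the later difference
    \<open>x - z = C \<subseteq> D\<close> inherits its sparseness.\<close>
  obtain D where D: "D \<subseteq> b1 - a1" "infinite D" "\<And>n. card (D \<inter> {..<g n}) \<le> n"
    using infinite_sparse_subset[of "b1 - a1" g] thins_silver[OF 1(1)] unfolding silver_def by blast
  define x where "x = a1 \<union> D"
  have xD: "x - a1 = D" using D(1) by (auto simp: x_def)
  have "a1 \<subseteq> x" "x \<subseteq> b1" using D(1) thins_silver[OF 1(1)] by (auto simp: x_def silver_def)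
  then have 2: "thins a1 b1 a1 x" "silver a1 x" using D(2) xD by (auto simp: thins_def silver_def)
  have dec1: "\<forall>i k. \<exists>m\<ge>k. decides (B1 i) m a1 x"
    using 0(2) decides_thins thins_trans[OF 1(1) 2(1)] by meson
  have dec2: "\<forall>i k. \<exists>m\<ge>k. decides (B2 i) m a1 x"
    using 1(2) decides_thins 2(1) by meson
  obtain C where C: "C \<subseteq> x - a1" "infinite C"
    "selectable B1 (X0 \<union> almost_between x x) (almost_between (x - C) (x \<union> C))"
    using gamma_thinning[OF 2(2) dec1 _ _ _ Un_upper2[of "almost_between x x" X0]] \<open>a1 \<subseteq> x\<close>
      cnt(1) countable_almost_between by blast
  define z where "z = x - C"
  have xz: "x - z = C" using C(1) by (auto simp: z_def)
  have 3: "thins a1 x z x" "silver z x" using C \<open>a1 \<subseteq> x\<close> xz by (auto simp: z_def thins_def silver_def)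
  have dec3: "\<forall>i k. \<exists>m\<ge>k. decides (B2 i) m z x"
    using dec2 decides_thins 3(1) by meson
  have "z \<subseteq> x" by (auto simp: z_def)
  then obtain C' where C': "C' \<subseteq> x - z" "infinite C'"
    "selectable B2 (Z0 \<union> almost_between z z) (almost_between (z - C') (z \<union> C'))"
    using gamma_thinning[OF 3(2) dec3 _ _ _ Un_upper2[of "almost_between z z" Z0]]
      cnt(2) countable_almost_between by blast
  \<comment> \<open>\<open>D1\<close> moves into the lower end and \<open>D2\<close> leaves the
    upper end. The infinite sets \<open>a' - z\<close> and \<open>x - b'\<close> obtained in this
    way keep differences of points from different stages infinite.\<close>
  obtain D1 D2 where S: "D1 \<subseteq> C'" "D2 \<subseteq> C'" "D1 \<inter> D2 = {}" "infinite D1" "infinite D2" "infinite (C' - D1 - D2)"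
    using infinite_split_three[OF C'(2)] by blast
  define a' where "a' = z \<union> D1"
  define b' where "b' = (z \<union> C') - D2"
  have "b' - a' = C' - D1 - D2" using C'(1) by (auto simp: a'_def b'_def)
  moreover have "a' \<subseteq> b'" using S C'(1) by (auto simp: a'_def b'_def)
  ultimately have s: "silver a' b'" using S(6) by (simp add: silver_def)
  have "a' - z = D1" using S(1) C'(1) by (auto simp: a'_def)
  moreover have "D2 \<subseteq> x - b'" using S(2) C'(1) by (auto simp: b'_def)
  ultimately have inf: "infinite (a' - z)" "infinite (x - b')" using S(4,5) finite_subset by auto
  have "(x - z) \<inter> {..<g n} \<subseteq> D \<inter> {..<g n}" for n using xz C(1) xD by blast
  then have "card ((x - z) \<inter> {..<g n}) \<le> n" for n
    using D(3)[of n] card_mono[of "D \<inter> {..<g n}"] by (meson finite_Int finite_lessThan le_trans)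
  moreover have "a \<subseteq> z" "x \<subseteq> b" using 0(1) 1(1) 3(1) \<open>x \<subseteq> b1\<close> by (auto simp: thins_def)
  moreover have "b' \<subseteq> x" using C'(1) \<open>z \<subseteq> x\<close> by (auto simp: b'_def)
  moreover have "selectable B1 (X0 \<union> almost_between x x) (almost_between a' b')"
    by (rule selectable_mono[OF C(3) almost_between_mono])
      (simp_all add: z_def[symmetric] a'_def Diff_eq_empty_iff[THEN iffD2] subset_trans[OF \<open>b' \<subseteq> x\<close> Un_upper1])
  moreover have "selectable B2 (Z0 \<union> almost_between z z) (almost_between a' b')"
    by (rule selectable_mono[OF C'(3) almost_between_mono])
      (auto simp: a'_def b'_def intro: finite_subset[OF _ finite.emptyI])
  ultimately show ?thesis using s inf \<open>z \<subseteq> x\<close> by (intro exI[of _ x] exI[of _ z] exI[of _ a'] exI[of _ b'])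
    (auto simp: a'_def)
qed

subsection \<open>Borel codes and the tower\<close>

text \<open>Borel codes, which show that there are no more Borel sets than reals: \<open>f\<close> labels the nodes of a
  well-founded tree, with \<open>0\<close> for the complement of a countable union and \<open>Suc k\<close> for the \<open>k\<close>-th cylinder.\<close>
inductive codes :: "(nat list \<Rightarrow> nat) \<Rightarrow> nat set set \<Rightarrow> bool" where
  cylinder: "f [] = Suc k \<Longrightarrow> from_nat k = (m, l) \<Longrightarrow> codes f {x. agree m (set l) x}"
| neg_UN: "f [] = 0 \<Longrightarrow> (\<And>n. codes (\<lambda>s. f (n # s)) (B n)) \<Longrightarrow> codes f (- (\<Union>n. B n))"

lemma codes_unique: "codes f B \<Longrightarrow> codes f B' \<Longrightarrow> B = B'"
proof (induction arbitrary: B' rule: codes.induct)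
  case (cylinder f k m l)
  from cylinder(3,1,2) show ?case by cases auto
next
  case (neg_UN f B)
  from neg_UN(4) show ?case
  proof cases
    case (neg_UN C)
    have "B n = C n" for n using neg_UN(3) \<open>\<And>n B'. codes (\<lambda>s. f (n # s)) B' \<Longrightarrow> B n = B'\<close> by blast
    then show ?thesis using neg_UN(1) by simp
  qed (use neg_UN(1) in simp)
qed

lemma codes_decidable: "codes f B \<Longrightarrow> decidable B"
proof (induction rule: codes.induct)
  case (cylinder f k m l)
  show ?case by (rule decidable_finite_support[of m]) (simp add: agree_def)
next
  case (neg_UN f B)
  then show ?case by (intro decidable_Compl decidable_UN)
qed

definition coded :: "nat set set \<Rightarrow> bool" where
  "coded B \<longleftrightarrow> (\<exists>f. codes f B)"

text \<open>Chosen codes of the sets \<open>B n\<close> become the subtrees below a new root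
  labelled \<open>0\<close>.\<close>

lemma coded_neg_UN:
  fixes B :: "nat \<Rightarrow> nat set set"
  assumes "\<And>n. coded (B n)"
  shows "coded (- (\<Union>n. B n))"
proof -
  obtain f where f: "\<And>n. codes (f n) (B n)" using assms unfolding coded_def by metis
  have "codes (\<lambda>s. case s of [] \<Rightarrow> 0 | n # s \<Rightarrow> f n s) (- (\<Union>n. B n))"
    by (rule codes.neg_UN) (simp_all add: f)
  then show ?thesis unfolding coded_def by blast
qed

lemma coded_Compl: "coded B \<Longrightarrow> coded (- B)"
  using coded_neg_UN[of "\<lambda>_. B"] by simp

lemma coded_UN:
  fixes B :: "nat \<Rightarrow> nat set set"
  shows "(\<And>n. coded (B n)) \<Longrightarrow> coded (\<Union>n. B n)"
  using coded_Compl[OF coded_neg_UN[of B]] by simp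

lemma coded_cylinder: "coded {x. agree m (set l) x}"
proof -
  have "codes (\<lambda>_. Suc (to_nat (m, l))) {x. agree m (set l) x}"
    by (rule codes.cylinder[OF refl]) simp
  then show ?thesis unfolding coded_def by blast
qed

lemma coded_empty: "coded {}"
  using coded_Compl[OF coded_cylinder[of 0 "[]"]] by (simp add: agree_def)

lemma coded_open:
  assumes "\<And>x. x \<in> U \<Longrightarrow> \<exists>m. \<forall>y. agree m x y \<longrightarrow> y \<in> U"
  shows "coded U"
proof -
  \<comment> \<open>All cylinders are enumerated; those not contained in \<open>U\<close> are
    replaced by the empty set below.\<close>
  define C where "C n = (case from_nat n of (m, l) \<Rightarrow> {x. agree m (set l) x})" for n
  have C: "coded (C n)" for n by (cases "from_nat n :: nat \<times> nat list") (simp add: C_def coded_cylinder)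
  have "x \<in> (\<Union>n. if C n \<subseteq> U then C n else {})" if "x \<in> U" for x
  proof -
    obtain m where m: "\<forall>y. agree m x y \<longrightarrow> y \<in> U" using assms \<open>x \<in> U\<close> by blast
    obtain l where l: "set l = x \<inter> {..<m}" using finite_list[of "x \<inter> {..<m}"] by auto
    define n where "n = to_nat (m, l)"
    have Cn: "C n = {y. agree m (set l) y}" by (simp add: C_def n_def)
    have "C n \<subseteq> U"
    proof
      fix y assume "y \<in> C n"
      then have "agree m x y" by (simp add: Cn l agree_def)
      then show "y \<in> U" using m by blast
    qed
    moreover have "x \<in> C n" by (simp add: Cn l agree_def)
    ultimately show ?thesis by auto
  qed
  moreover have "(\<Union>n. if C n \<subseteq> U then C n else {}) \<subseteq> U" by auto
  ultimately have "U = (\<Union>n. if C n \<subseteq> U then C n else {})" by blast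
  moreover have "coded (\<Union>n. if C n \<subseteq> U then C n else {})" by (rule coded_UN) (simp add: C coded_empty)
  ultimately show ?thesis by simp
qed

text \<open>The default \<open>{}\<close> makes every labelling name a decidable set, so tasks with
  ill-formed codes can be processed like all others.\<close>

definition decode :: "(nat list \<Rightarrow> nat) \<Rightarrow> nat set set" where
  "decode f = (if \<exists>B. codes f B then THE B. codes f B else {})"

lemma decode_eq:
  assumes "codes f B"
  shows "decode f = B"
proof -
  have "(THE B. codes f B) = B" using assms codes_unique by (intro the_equality)
  then show ?thesis using assms by (auto simp: decode_def)
qed

lemma decidable_decode: "decidable (decode f)"
proof (cases "\<exists>B. codes f B")
  case True
  then show ?thesis using codes_decidable decode_eq by metis
next
  case False
  then have "decode f = {}" by (simp add: decode_def)
  then show ?thesis using coded_empty codes_decidable unfolding coded_def by metis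
qed

text \<open>A task codes a function and two sequences of Borel sets, tagged by the first component \<open>0\<close>, \<open>1\<close>, \<open>2\<close>.\<close>
type_synonym task = "nat \<times> nat \<times> nat list \<Rightarrow> nat"

definition task_fun :: "task \<Rightarrow> nat \<Rightarrow> nat" where
  "task_fun t n = t (0, n, [])"

definition task_sets :: "nat \<Rightarrow> task \<Rightarrow> nat \<Rightarrow> nat set set" where
  "task_sets j t i = decode (\<lambda>s. t (Suc j, i, s))"

lemma task_fun_surj: "\<exists>t. task_fun t = g"
  by (rule exI[of _ "\<lambda>(c, n, s). g n"]) (simp add: task_fun_def fun_eq_iff)

lemma task_sets_surj:
  assumes "\<And>i. coded (B i)"
  shows "\<exists>t. task_sets j t = B"
proof -
  obtain f where f: "\<And>i. codes (f i) (B i)" using assms unfolding coded_def by metis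
  have "task_sets j (\<lambda>(c, i, s). f i s) = B"
    using decode_eq[OF f] by (simp add: task_sets_def fun_eq_iff)
  then show ?thesis by blast
qed

section \<open>The tower of conditions\<close>

text \<open>A nonempty finite \<open>F\<close> has an \<open>r\<close>-largest element
  \<open>u\<close>; all but finitely many free coordinates of its condition are free in the
  conditions of all members of \<open>F\<close>.\<close>

lemma tower_inf:
  fixes r :: "('i \<times> 'i) set" and p q :: "'i \<Rightarrow> nat set"
  assumes tot: "\<And>s t. s = t \<or> (s, t) \<in> r \<or> (t, s) \<in> r" and "trans r"
    and sil: "\<And>s. s \<in> I \<Longrightarrow> silver (p s) (q s)"
    and dec: "\<And>s t. s \<in> I \<Longrightarrow> t \<in> I \<Longrightarrow> (s, t) \<in> r \<Longrightarrow> finite (p s - p t) \<and> finite (q t - q s)"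
    and F: "finite F" "F \<subseteq> I"
  shows "infinite ((\<Inter>s\<in>F. q s) - (\<Union>s\<in>F. p s))"
proof (cases "F = {}")
  case False
  have "\<exists>u\<in>F. \<forall>s\<in>F. s = u \<or> (s, u) \<in> r"
    using F(1) False
  proof (induction rule: finite_ne_induct)
    case (insert x F)
    then obtain u where u: "u \<in> F" "\<forall>s\<in>F. s = u \<or> (s, u) \<in> r" by blast
    show ?case
    proof (cases "(u, x) \<in> r")
      case True
      then have "\<forall>s\<in>insert x F. s = x \<or> (s, x) \<in> r" using u(2) transD[OF \<open>trans r\<close>] by (metis insert_iff)
      then show ?thesis by blast
    next
      case False
      then have "x = u \<or> (x, u) \<in> r" using tot[of u x] by blast
      then show ?thesis using u by blast
    qed
  qed simp
  then obtain u where u: "u \<in> F" "\<And>s. s \<in> F \<Longrightarrow> s = u \<or> (s, u) \<in> r" by blast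
  have fin: "finite (p s - p u) \<and> finite (q u - q s)" if "s \<in> F" for s
    using u(2)[OF that] dec[of s u] that u(1) F(2) by (cases "s = u") auto
  have "finite ((\<Union>s\<in>F. p s - p u) \<union> (\<Union>s\<in>F. q u - q s))" 
    using fin by (intro finite_UnI finite_UN_I F(1)) blast+
  moreover have "infinite (q u - p u)" using sil u(1) F(2) by (auto simp: silver_def)
  ultimately have "infinite ((q u - p u) - ((\<Union>s\<in>F. p s - p u) \<union> (\<Union>s\<in>F. q u - q s)))"
    by (rule Diff_infinite_finite)
  moreover have "(q u - p u) - ((\<Union>s\<in>F. p s - p u) \<union> (\<Union>s\<in>F. q u - q s)) \<subseteq> (\<Inter>s\<in>F. q s) - (\<Union>s\<in>F. p s)"
    by blast
  ultimately show ?thesis using finite_subset by blast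
qed simp

text \<open>Recursion along \<open>r\<close>: task \<open>t\<close> is handled at stage \<open>t\<close>, starting from an almost-lower bound of the
  conditions \<open>(p s, q s)\<close> for \<open>s\<close> before \<open>t\<close>.\<close>
lemma tower_exists:
  fixes r :: "(task \<times> task) set"
  assumes "wf r" "trans r" and tot: "\<And>s t. s = t \<or> (s, t) \<in> r \<or> (t, s) \<in> r"
    and cnt: "\<And>t. countable {s. (s, t) \<in> r}"
  obtains x z p q :: "task \<Rightarrow> nat set" where
    "\<And>s t. (s, t) \<in> r \<Longrightarrow> finite (p s - z t) \<and> finite (x t - q s)"
    "\<And>t. z t \<subseteq> x t" "\<And>t. z t \<subseteq> p t" "\<And>t. q t \<subseteq> x t" "\<And>t. silver (p t) (q t)"
    "\<And>t. infinite (p t - z t)" "\<And>t. infinite (x t - q t)"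
    "\<And>t n. card ((x t - z t) \<inter> {..<task_fun t n}) \<le> n"
    "\<And>t. selectable (task_sets 0 t)
      ((\<Union>s\<in>{s. (s, t) \<in> r}. almost_between (x s) (x s)) \<union> almost_between (x t) (x t))
      (almost_between (p t) (q t))"
    "\<And>t. selectable (task_sets 1 t)
      ((\<Union>s\<in>{s. (s, t) \<in> r}. almost_between (z s) (z s)) \<union> almost_between (z t) (z t))
      (almost_between (p t) (q t))"
proof -
  \<comment> \<open>A value \<open>(x, z, p, q)\<close> consists of the two points of stage
    \<open>t\<close> and the condition handed on to later stages; \<open>f\<close> supplies the
    earlier values.\<close>
  define P where "P f t y \<longleftrightarrow> (case y of (x, z, p, q) \<Rightarrow>
     (\<forall>s. (s, t) \<in> r \<longrightarrow> finite (fst (snd (snd (f s))) - z) \<and> finite (x - snd (snd (snd (f s))))) \<and>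
     z \<subseteq> x \<and> z \<subseteq> p \<and> q \<subseteq> x \<and> silver p q \<and> infinite (p - z) \<and> infinite (x - q) \<and>
     (\<forall>n. card ((x - z) \<inter> {..<task_fun t n}) \<le> n) \<and>
     selectable (task_sets 0 t)
      ((\<Union>s\<in>{s. (s, t) \<in> r}. almost_between (fst (f s)) (fst (f s))) \<union> almost_between x x)
      (almost_between p q) \<and>
     selectable (task_sets 1 t)
      ((\<Union>s\<in>{s. (s, t) \<in> r}. almost_between (fst (snd (f s))) (fst (snd (f s)))) \<union> almost_between z z)
      (almost_between p q))"
    for f :: "task \<Rightarrow> nat set \<times> nat set \<times> nat set \<times> nat set" and t y
  have "\<exists>f. \<forall>t. P f t (f t)"
  proof (rule dependent_wf_choice[OF \<open>wf r\<close>])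
    fix f g :: "task \<Rightarrow> nat set \<times> nat set \<times> nat set \<times> nat set" and t y
    assume fg: "\<And>s. (s, t) \<in> r \<Longrightarrow> f s = g s"
    have "(\<Union>s\<in>{s. (s, t) \<in> r}. almost_between (fst (f s)) (fst (f s))) =
        (\<Union>s\<in>{s. (s, t) \<in> r}. almost_between (fst (g s)) (fst (g s)))"
      "(\<Union>s\<in>{s. (s, t) \<in> r}. almost_between (fst (snd (f s))) (fst (snd (f s)))) =
        (\<Union>s\<in>{s. (s, t) \<in> r}. almost_between (fst (snd (g s))) (fst (snd (g s))))"
      "(\<forall>s. (s, t) \<in> r \<longrightarrow> finite (fst (snd (snd (f s))) - z) \<and> finite (x - snd (snd (snd (f s))))) \<longleftrightarrow>
       (\<forall>s. (s, t) \<in> r \<longrightarrow> finite (fst (snd (snd (g s))) - z) \<and> finite (x - snd (snd (snd (g s)))))" for x z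
      using fg by simp_all
    then show "P f t y = P g t y" unfolding P_def by presburger
  next
    fix t and f :: "task \<Rightarrow> nat set \<times> nat set \<times> nat set \<times> nat set"
    assume IH: "\<And>s. (s, t) \<in> r \<Longrightarrow> P f s (f s)"
    define p where "p s = fst (snd (snd (f s)))" for s
    define q where "q s = snd (snd (snd (f s)))" for s
    define I where "I = {s. (s, t) \<in> r}"
    have sil: "silver (p s) (q s)" if "s \<in> I" for s
      using IH[of s] that unfolding P_def case_prod_beta p_def q_def I_def by simp
    have dec: "finite (p s - p u) \<and> finite (q u - q s)" if "s \<in> I" "u \<in> I" and su: "(s, u) \<in> r" for s u
    proof -
      have "P f u (f u)" using IH[of u] that(2) by (simp add: I_def)
      \<comment> \<open>The points of stage \<open>u\<close> lie in between: \<open>p s\<close> is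
        almost contained in \<open>z \<subseteq> p u\<close>, and \<open>q u \<subseteq> x\<close>
        is almost contained in \<open>q s\<close>.\<close>
      then obtain x z where "finite (p s - z)" "finite (x - q s)" "z \<subseteq> p u" "q u \<subseteq> x"
        using su unfolding P_def case_prod_beta p_def q_def by blast
      moreover have "p s - p u \<subseteq> p s - z" "q u - q s \<subseteq> x - q s" using calculation by auto
      ultimately show ?thesis using finite_subset by metis
    qed
    have fin: "finite (p s - q u)" if "s \<in> I" "u \<in> I" for s u
    proof -
      have "p s \<subseteq> q s" "p u \<subseteq> q u" using sil that by (auto simp: silver_def)
      then have sub: "p s - q u \<subseteq> p s - p u" "p s - q u \<subseteq> q s - q u" by auto
      consider "s = u" | "(s, u) \<in> r" | "(u, s) \<in> r" using tot by blast
      then show ?thesis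
      proof cases
        case 1
        then show ?thesis using \<open>p u \<subseteq> q u\<close> by (simp add: Diff_eq_empty_iff[THEN iffD2])
      next
        case 2
        then show ?thesis using dec[of s u] that sub by (metis finite_subset)
      next
        case 3
        then show ?thesis using dec[of u s] that sub by (metis finite_subset)
      qed
    qed
    have "countable I" using cnt by (simp add: I_def)
    \<comment> \<open>Since \<open>I\<close> may be any countable set, initial, successor and limit
      stages are treated alike.\<close>
    from countable_lower_bound[where a = p and b = q, OF this fin
        tower_inf[where p = p and q = q and I = I, OF tot \<open>trans r\<close> sil dec]]
    obtain c d where cd: "silver c d" "\<And>s. s \<in> I \<Longrightarrow> finite (p s - c) \<and> finite (d - q s)" by blast
    define X0 where "X0 = (\<Union>s\<in>I. almost_between (fst (f s)) (fst (f s)))"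
    define Z0 where "Z0 = (\<Union>s\<in>I. almost_between (fst (snd (f s))) (fst (snd (f s))))"
    have "countable X0" "countable Z0"
      using \<open>countable I\<close> countable_almost_between by (auto simp: X0_def Z0_def)
    moreover have "decidable (task_sets 0 t i)" "decidable (task_sets 1 t i)" for i
      by (simp_all add: task_sets_def decidable_decode)
    ultimately obtain x z a' b' where s: "c \<subseteq> z" "z \<subseteq> x" "x \<subseteq> d" "z \<subseteq> a'" "b' \<subseteq> x" "silver a' b'"
      "infinite (a' - z)" "infinite (x - b')" "\<forall>n. card ((x - z) \<inter> {..<task_fun t n}) \<le> n"
      "selectable (task_sets 0 t) (X0 \<union> almost_between x x) (almost_between a' b')"
      "selectable (task_sets 1 t) (Z0 \<union> almost_between z z) (almost_between a' b')"
      using successor_step[OF cd(1), of "task_sets 0 t" "task_sets 1 t" X0 Z0 "task_fun t"] by blast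
    have "finite (p s - z) \<and> finite (x - q s)" if "(s, t) \<in> r" for s
    proof -
      have "p s - z \<subseteq> p s - c" "x - q s \<subseteq> d - q s" using s by auto
      then show ?thesis using cd(2)[of s] that finite_subset unfolding I_def by blast
    qed
    then have "P f t (x, z, a', b')"
      unfolding P_def prod.case using s by (simp add: p_def q_def X0_def Z0_def I_def)
    then show "\<exists>y. P f t y" by blast
  qed
  then obtain f where f: "\<And>t. P f t (f t)" by blast
  show thesis
    by (rule that[where x = "\<lambda>t. fst (f t)" and z = "\<lambda>t. fst (snd (f t))"
        and p = "\<lambda>t. fst (snd (snd (f t)))" and q = "\<lambda>t. snd (snd (snd (f t)))"])
      (insert f, simp_all add: P_def case_prod_beta)
qed

text \<open>The covering hypothesis passes down from \<open>X\<close> to \<open>E\<close>, and the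
  sequence selected for \<open>E \<union> R\<close> serves every point of \<open>X\<close>.\<close>

lemma selectable_transfer:
  assumes "selectable B E R" "E \<subseteq> X" "X \<subseteq> E \<union> R"
  shows "selectable B X X"
  unfolding selectable_def
proof
  assume "\<forall>F. finite F \<longrightarrow> F \<subseteq> X \<longrightarrow> (\<exists>i. F \<subseteq> B i)"
  then have "\<forall>F. finite F \<longrightarrow> F \<subseteq> E \<longrightarrow> (\<exists>i. F \<subseteq> B i)" using assms(2) by (meson subset_trans)
  with assms(1) have "\<exists>i :: nat \<Rightarrow> nat. \<forall>x\<in>E \<union> R. \<exists>N. \<forall>n\<ge>N. x \<in> B (i n)"
    unfolding selectable_def by (rule mp)
  then obtain i :: "nat \<Rightarrow> nat" where "\<forall>x\<in>E \<union> R. \<exists>N. \<forall>n\<ge>N. x \<in> B (i n)" ..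
  then have "\<forall>x\<in>X \<union> X. \<exists>N. \<forall>n\<ge>N. x \<in> B (i n)" using assms(3) by (meson Un_iff subsetD)
  then show "\<exists>i :: nat \<Rightarrow> nat. \<forall>x\<in>X \<union> X. \<exists>N. \<forall>n\<ge>N. x \<in> B (i n)"
    by (intro exI[of _ i])
qed

text \<open>Stage \<open>t\<close> settles task \<open>t\<close> for good: the points of stages up
  to \<open>t\<close> form the set \<open>E\<close> of its selection, and the points of later stages
  lie in \<open>almost_between (p t) (q t)\<close>.\<close>

lemma nat_set_families:
  fixes r :: "(task \<times> task) set"
  assumes "wf r" "trans r" and tot: "\<And>s t. s = t \<or> (s, t) \<in> r \<or> (t, s) \<in> r"
    and cnt: "\<And>t. countable {s. (s, t) \<in> r}"
  obtains X Z :: "nat set set" where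
    "\<And>x z. x \<in> X \<Longrightarrow> z \<in> Z \<Longrightarrow> infinite (x - z)"
    "\<And>g. \<exists>x\<in>X. \<exists>z\<in>Z. \<forall>n. card ((x - z) \<inter> {..<g n}) \<le> n"
    "\<And>B. \<forall>i. coded (B i) \<Longrightarrow> selectable B X X"
    "\<And>B. \<forall>i. coded (B i) \<Longrightarrow> selectable B Z Z"
proof -
  obtain x z p q :: "task \<Rightarrow> nat set" where
    dec: "\<And>s t. (s, t) \<in> r \<Longrightarrow> finite (p s - z t) \<and> finite (x t - q s)"
    and sub: "\<And>t. z t \<subseteq> x t" "\<And>t. z t \<subseteq> p t" "\<And>t. q t \<subseteq> x t" "\<And>t. silver (p t) (q t)"
    and inf: "\<And>t. infinite (p t - z t)" "\<And>t. infinite (x t - q t)"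
    and sparse: "\<And>t n. card ((x t - z t) \<inter> {..<task_fun t n}) \<le> n"
    and selX: "\<And>t. selectable (task_sets 0 t)
      ((\<Union>s\<in>{s. (s, t) \<in> r}. almost_between (x s) (x s)) \<union> almost_between (x t) (x t))
      (almost_between (p t) (q t))"
    and selZ: "\<And>t. selectable (task_sets 1 t)
      ((\<Union>s\<in>{s. (s, t) \<in> r}. almost_between (z s) (z s)) \<union> almost_between (z t) (z t))
      (almost_between (p t) (q t))"
    by (rule tower_exists[OF assms]) (rule that; assumption)
  have pq: "p t \<subseteq> q t" for t using sub(4) by (simp add: silver_def)
  define X where "X = (\<Union>t. almost_between (x t) (x t))"
  define Z where "Z = (\<Union>t. almost_between (z t) (z t))"
  \<comment> \<open>The earlier stage has reserved infinitely many coordinates, almost all of which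
    lie in the difference: \<open>x s - q s\<close> if \<open>s\<close> comes first, otherwise
    \<open>p t - z t\<close>.\<close>
  have xz: "infinite (x s - z t)" for s t
  proof -
    consider "s = t" | "(s, t) \<in> r" | "(t, s) \<in> r" using tot by blast
    then show ?thesis
    proof cases
      case 1
      have "p s - z s \<subseteq> x s - z s" using pq sub(3) by blast
      then show ?thesis using inf(1)[of s] 1 finite_subset by blast
    next
      case 2
      have "infinite ((x s - q s) - (x t - q s))"
        using inf(2)[of s] dec[OF 2] by (simp add: Diff_infinite_finite)
      moreover have "(x s - q s) - (x t - q s) \<subseteq> x s - z t" using sub(1) by blast
      ultimately show ?thesis using finite_subset by blast
    next
      case 3
      have "infinite ((p t - z t) - (p t - z s))"
        using inf(1)[of t] dec[OF 3] by (simp add: Diff_infinite_finite)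
      moreover have "(p t - z t) - (p t - z s) \<subseteq> x s - z t" using sub(1) by blast
      ultimately show ?thesis using finite_subset by blast
    qed
  qed
  show thesis
  proof (rule that[of X Z])
    fix u v assume "u \<in> X" "v \<in> Z"
    then obtain s t where "finite (x s - u)" "finite (v - z t)" by (auto simp: X_def Z_def almost_between_def)
    then have "infinite ((x s - z t) - ((x s - u) \<union> (v - z t)))"
      using xz[of s t] by (simp add: Diff_infinite_finite)
    moreover have "(x s - z t) - ((x s - u) \<union> (v - z t)) \<subseteq> u - v" by blast
    ultimately show "infinite (u - v)" using finite_subset by blast
  next
    fix g
    obtain t where t: "task_fun t = g" using task_fun_surj by blast
    have "x t \<in> almost_between (x t) (x t)" "z t \<in> almost_between (z t) (z t)"
      by (simp_all add: almost_between_def)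
    then have "x t \<in> X" "z t \<in> Z" by (auto simp: X_def Z_def)
    then show "\<exists>x\<in>X. \<exists>z\<in>Z. \<forall>n. card ((x - z) \<inter> {..<g n}) \<le> n"
      using sparse[of t] unfolding t by blast
  next
    fix B :: "nat \<Rightarrow> nat set set" assume "\<forall>i. coded (B i)"
    then obtain t where t: "task_sets 0 t = B" using task_sets_surj by blast
    let ?E = "(\<Union>s\<in>{s. (s, t) \<in> r}. almost_between (x s) (x s)) \<union> almost_between (x t) (x t)"
    \<comment> \<open>For \<open>s\<close> after \<open>t\<close>, modulo finite sets,
      \<open>p t \<subseteq> z s \<subseteq> x s \<subseteq> q t\<close>.\<close>
    have "almost_between (x s) (x s) \<subseteq> ?E \<union> almost_between (p t) (q t)" for s
    proof (cases "(t, s) \<in> r")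
      case True
      have "p t - x s \<subseteq> p t - z s" using sub(1) by blast
      then have "finite (p t - x s)" using dec[OF True] finite_subset by blast
      then have "almost_between (x s) (x s) \<subseteq> almost_between (p t) (q t)"
        using dec[OF True] by (intro almost_between_mono) auto
      then show ?thesis by blast
    next
      case False
      then show ?thesis using tot[of s t] by blast
    qed
    then have "X \<subseteq> ?E \<union> almost_between (p t) (q t)" unfolding X_def by blast
    moreover have "?E \<subseteq> X" unfolding X_def by blast
    ultimately show "selectable B X X" using selX[of t] selectable_transfer unfolding t by blast
  next
    fix B :: "nat \<Rightarrow> nat set set" assume "\<forall>i. coded (B i)"
    then obtain t where t: "task_sets 1 t = B" using task_sets_surj by blast
    let ?E = "(\<Union>s\<in>{s. (s, t) \<in> r}. almost_between (z s) (z s)) \<union> almost_between (z t) (z t)"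
    have "almost_between (z s) (z s) \<subseteq> ?E \<union> almost_between (p t) (q t)" for s
    proof (cases "(t, s) \<in> r")
      case True
      have "z s - q t \<subseteq> x s - q t" using sub(1) by blast
      then have "finite (z s - q t)" using dec[OF True] finite_subset by blast
      then have "almost_between (z s) (z s) \<subseteq> almost_between (p t) (q t)"
        using dec[OF True] by (intro almost_between_mono) auto
      then show ?thesis by blast
    next
      case False
      then show ?thesis using tot[of s t] by blast
    qed
    then have "Z \<subseteq> ?E \<union> almost_between (p t) (q t)" unfolding Z_def by blast
    moreover have "?E \<subseteq> Z" unfolding Z_def by blast
    ultimately show "selectable B Z Z" using selZ[of t] selectable_transfer unfolding t by blast
  qed
qed

subsection \<open>Transfer to the real line\<close>

text \<open>The range is the ternary Cantor set enlarged by the factor \<open>3/2\<close>. Digits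
  \<open>0\<close> and \<open>1\<close> in base \<open>3\<close> leave gaps, which make the map an
  embedding.\<close>

definition cantor :: "nat set \<Rightarrow> real" where
  "cantor x = (\<Sum>n. if n \<in> x then (1/3) ^ n else 0)"

definition cantor_tail :: "nat \<Rightarrow> nat set \<Rightarrow> real" where
  "cantor_tail m x = (\<Sum>n. if n + m \<in> x then (1/3) ^ (n + m) else 0)"

lemma summable_cantor_tail: "summable (\<lambda>n. if n + m \<in> x then (1/3 :: real) ^ (n + m) else 0)"
proof (rule summable_comparison_test')
  show "summable (\<lambda>n. (1/3 :: real) ^ n)" by (simp add: summable_geometric)
  fix n
  have "(1/3 :: real) ^ (n + m) \<le> (1/3) ^ n" by (rule power_decreasing) auto
  then show "norm (if n + m \<in> x then (1/3 :: real) ^ (n + m) else 0) \<le> (1/3) ^ n" by simp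
qed

lemma cantor_tail_bounds: "0 \<le> cantor_tail m x" "cantor_tail m x \<le> 3/2 * (1/3) ^ m"
proof -
  show "0 \<le> cantor_tail m x"
    unfolding cantor_tail_def by (rule suminf_nonneg[OF summable_cantor_tail]) simp
  have s: "summable (\<lambda>n. (1/3 :: real) ^ n * (1/3) ^ m)"
    by (intro summable_mult2) (simp add: summable_geometric)
  have "cantor_tail m x \<le> (\<Sum>n. (1/3 :: real) ^ n * (1/3) ^ m)"
    unfolding cantor_tail_def by (rule suminf_le[OF _ summable_cantor_tail s]) (simp add: power_add)
  also have "\<dots> = 3/2 * (1/3) ^ m"
    by (subst suminf_mult2[symmetric]) (simp_all add: summable_geometric suminf_geometric)
  finally show "cantor_tail m x \<le> 3/2 * (1/3) ^ m" .
qed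

lemma cantor_split: "cantor x = cantor_tail m x + (\<Sum>n<m. if n \<in> x then (1/3) ^ n else 0)"
  using suminf_split_initial_segment[OF summable_cantor_tail[of 0 x, unfolded add_0_right], of m]
  unfolding cantor_def cantor_tail_def .

lemma cantor_diff:
  assumes "agree m x y"
  shows "cantor x - cantor y = cantor_tail m x - cantor_tail m y"
proof -
  have "(\<Sum>n<m. if n \<in> x then (1/3) ^ n else 0) = (\<Sum>n<m. if n \<in> y then (1/3 :: real) ^ n else 0)"
    using assms by (intro sum.cong) (auto simp: agree_def)
  then show ?thesis using cantor_split[of x m] cantor_split[of y m] by simp
qed

lemma cantor_agree:
  assumes "agree m x y"
  shows "\<bar>cantor x - cantor y\<bar> \<le> 3/2 * (1/3) ^ m"
  using cantor_diff[OF assms] cantor_tail_bounds[of m x] cantor_tail_bounds[of m y] by linarith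

text \<open>The digit at \<open>n\<close> contributes \<open>(1/3) ^ n\<close>, while all later
  digits together amount to at most half of that.\<close>

lemma cantor_first_difference:
  assumes "agree n x y" "n \<in> x" "n \<notin> y"
  shows "(1/3) ^ n / 2 \<le> cantor x - cantor y"
proof -
  have t: "cantor_tail n u = cantor_tail (Suc n) u + (if n \<in> u then (1/3) ^ n else 0)" for u
    using cantor_split[of u n] cantor_split[of u "Suc n"] by simp
  have "cantor_tail (Suc n) y \<le> (1/3) ^ n / 2" using cantor_tail_bounds(2)[of "Suc n" y] by simp
  then show ?thesis
    using cantor_diff[OF assms(1)] t[of x] t[of y] assms(2,3) cantor_tail_bounds(1)[of "Suc n" x] by simp
qed

text \<open>This is uniform continuity of the inverse map; \<open>cantor_first_difference\<close>
  applies at the least coordinate where \<open>x\<close> and \<open>y\<close> differ.\<close>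

lemma cantor_close:
  assumes "\<bar>cantor x - cantor y\<bar> < (1/3) ^ m / 2"
  shows "agree m x y"
proof (rule ccontr)
  assume "\<not> agree m x y"
  then have "\<exists>n. n < m \<and> \<not> (n \<in> x \<longleftrightarrow> n \<in> y)" by (auto simp: agree_def)
  then obtain n where n: "n < m" "\<not> (n \<in> x \<longleftrightarrow> n \<in> y)" "\<forall>i<n. \<not> (i < m \<and> \<not> (i \<in> x \<longleftrightarrow> i \<in> y))"
    using exists_least_iff[of "\<lambda>n. n < m \<and> \<not> (n \<in> x \<longleftrightarrow> n \<in> y)"] by metis
  then have ag: "agree n x y" "agree n y x" by (auto simp: agree_def)
  have "(1/3) ^ n / 2 \<le> \<bar>cantor x - cantor y\<bar>"
  proof (cases "n \<in> x")
    case True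
    then show ?thesis using n(2) cantor_first_difference[OF ag(1)] by linarith
  next
    case False
    then show ?thesis using n(2) cantor_first_difference[OF ag(2)] by linarith
  qed
  moreover have "(1/3 :: real) ^ m \<le> (1/3) ^ n" using n(1) by (intro power_decreasing) auto
  ultimately show False using assms by linarith
qed

lemma inj_cantor: "inj cantor"
proof (rule injI)
  fix x y assume "cantor x = cantor y"
  then have "agree (Suc n) x y" for n by (intro cantor_close) simp
  then show "x = y" by (auto simp: agree_def)
qed

section \<open>Borel covers of the embedded sets\<close>

lemma coded_vimage_open:
  assumes "open G"
  shows "coded {x. cantor x \<in> G}"
proof (rule coded_open)
  fix x assume "x \<in> {x. cantor x \<in> G}"
  then obtain e where e: "e > 0" "\<And>v. dist v (cantor x) < e \<Longrightarrow> v \<in> G"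
    using assms by (auto simp: open_dist)
  have "(\<lambda>m. 3/2 * (1/3 :: real) ^ m) \<longlonglongrightarrow> 0" by (intro tendsto_mult_right_zero LIMSEQ_power_zero) simp
  then have "\<forall>\<^sub>F m in sequentially. 3/2 * (1/3 :: real) ^ m < e" using e(1) by (rule order_tendstoD)
  then obtain m where m: "3/2 * (1/3 :: real) ^ m < e" by (auto simp: eventually_sequentially)
  have "cantor y \<in> G" if "agree m x y" for y
    using cantor_agree[OF that] m by (intro e(2)) (simp add: dist_real_def abs_minus_commute)
  then show "\<exists>m. \<forall>y. agree m x y \<longrightarrow> y \<in> {x. cantor x \<in> G}" by blast
qed

text \<open>The coded set has to be right on \<open>X\<close> only, so complements relative to the
  image can be replaced by full complements in the induction.\<close>

lemma borel_coded:
  assumes "U \<in> borel_sets_of (top_of_set (cantor ` X))"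
  shows "\<exists>B. coded B \<and> (\<forall>x\<in>X. cantor x \<in> U \<longleftrightarrow> x \<in> B)"
  using assms unfolding borel_sets_of_def
proof (induction rule: sigma_sets.induct)
  case (Basic U)
  then obtain G where G: "open G" "U = cantor ` X \<inter> G" by (auto simp: openin_open)
  show ?case by (rule exI[of _ "{x. cantor x \<in> G}"]) (simp add: G coded_vimage_open)
next
  case Empty
  show ?case by (rule exI[of _ "{}"]) (simp add: coded_empty)
next
  case (Compl U)
  then obtain B where "coded B" "\<forall>x\<in>X. cantor x \<in> U \<longleftrightarrow> x \<in> B" by blast
  then show ?case by (intro exI[of _ "- B"]) (simp add: coded_Compl)
next
  case (Union U)
  then have "\<forall>n. \<exists>B. coded B \<and> (\<forall>x\<in>X. cantor x \<in> U n \<longleftrightarrow> x \<in> B)" by blast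
  then obtain B where B: "\<And>n :: nat. coded (B n)" "\<And>n. \<forall>x\<in>X. cantor x \<in> U n \<longleftrightarrow> x \<in> B n" by metis
  then show ?case by (intro exI[of _ "\<Union>n. B n"]) (simp add: coded_UN)
qed

text \<open>Along an enumeration of the cover, \<open>selectable\<close> yields a sequence of
  members that eventually contain each given point; its range is the
  \<open>\<gamma>\<close>-cover.\<close>

lemma choose_property_cantor:
  assumes sel: "\<And>B. \<forall>i. coded (B i) \<Longrightarrow> selectable B X X"
  shows "choose_property (borel_omega_covers (top_of_set (cantor ` X)))
    (borel_gamma_covers (top_of_set (cantor ` X)))"
  unfolding choose_property_def
proof
  fix \<U> assume "\<U> \<in> borel_omega_covers (top_of_set (cantor ` X))"
  then have *: "cantor ` X = \<Union>\<U> \<and> (\<forall>U\<in>\<U>. \<not> cantor ` X \<subseteq> U) \<and> countable \<U> \<and>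
      \<U> \<subseteq> borel_sets_of (top_of_set (cantor ` X)) \<and>
      (\<forall>F. finite F \<and> F \<subseteq> cantor ` X \<longrightarrow> (\<exists>U\<in>\<U>. F \<subseteq> U))"
    unfolding borel_omega_covers_def countable_borel_covers_def is_cover_def mem_Collect_eq
      topspace_euclidean_subtopology conj_assoc .
  note U = conjunct1[OF *] conjunct1[OF conjunct2[OF *], rule_format]
    conjunct1[OF conjunct2[OF conjunct2[OF *]]]
    conjunct1[OF conjunct2[OF conjunct2[OF conjunct2[OF *]]]]
    conjunct2[OF conjunct2[OF conjunct2[OF conjunct2[OF *]]], rule_format]
  have "\<U> \<noteq> {}" using U(5)[of "{}"] by auto
  define u where "u = from_nat_into \<U>"
  have u: "range u = \<U>" unfolding u_def by (rule range_from_nat_into[OF \<open>\<U> \<noteq> {}\<close> U(3)])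
  then have "\<forall>n. \<exists>B. coded B \<and> (\<forall>x\<in>X. cantor x \<in> u n \<longleftrightarrow> x \<in> B)" using borel_coded U(4) by blast
  then obtain B where B: "\<And>n. coded (B n)" "\<And>n x. x \<in> X \<Longrightarrow> cantor x \<in> u n \<longleftrightarrow> x \<in> B n" by metis
  have cov: "\<exists>i. F \<subseteq> B i" if F: "finite F" "F \<subseteq> X" for F
  proof -
    obtain U where "U \<in> \<U>" "cantor ` F \<subseteq> U" using U(5)[of "cantor ` F"] F by blast
    moreover then obtain i where "U = u i" using u by blast
    ultimately have "F \<subseteq> B i" using B(2) F(2) by blast
    then show ?thesis ..
  qed
  have "selectable B X X" using sel B(1) by blast
  then have "\<exists>i :: nat \<Rightarrow> nat. \<forall>x\<in>X \<union> X. \<exists>N. \<forall>n\<ge>N. x \<in> B (i n)"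
    unfolding selectable_def using cov by (elim mp) simp
  then obtain i :: "nat \<Rightarrow> nat" where i: "\<And>x. x \<in> X \<Longrightarrow> \<exists>N. \<forall>n\<ge>N. x \<in> B (i n)"
    by auto
  have ev: "\<exists>N. \<forall>n\<ge>N. r \<in> u (i n)" if "r \<in> cantor ` X" for r
    using that i B(2) by auto
  define \<V> where "\<V> = range (\<lambda>n. u (i n))"
  have VU: "\<V> \<subseteq> \<U>" using u by (auto simp: \<V>_def)
  have cover: "cantor ` X = \<Union>\<V>"
  proof
    show "cantor ` X \<subseteq> \<Union>\<V>" using ev unfolding \<V>_def by blast
    show "\<Union>\<V> \<subseteq> cantor ` X" using U(1) VU by blast
  qed
  have inf: "infinite \<V>"
  proof
    assume "finite \<V>"
    \<comment> \<open>A finite range repeats one member infinitely often. That member contains every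
      point, which contradicts properness of the cover.\<close>
    then obtain n0 where "infinite {n. u (i n) = u (i n0)}"
      using pigeonhole_infinite[of UNIV "\<lambda>n. u (i n)"] by (auto simp: \<V>_def)
    then have "r \<in> u (i n0)" if "r \<in> cantor ` X" for r
      using ev[OF that] unfolding infinite_nat_iff_unbounded_le by (metis mem_Collect_eq)
    then show False using U(2)[of "u (i n0)"] u by blast
  qed
  have fin: "finite {V \<in> \<V>. r \<notin> V}" if "r \<in> cantor ` X" for r
  proof -
    obtain N where N: "\<And>n. n \<ge> N \<Longrightarrow> r \<in> u (i n)" using ev[OF \<open>r \<in> cantor ` X\<close>] by blast
    have "{V \<in> \<V>. r \<notin> V} \<subseteq> (\<lambda>n. u (i n)) ` {..<N}"
      using N by (auto simp: \<V>_def) (metis imageI lessThan_iff not_less)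
    then show ?thesis by (rule finite_subset) simp
  qed
  have "\<V> \<in> borel_gamma_covers (top_of_set (cantor ` X))"
    unfolding borel_gamma_covers_def countable_borel_covers_def is_cover_def mem_Collect_eq
      topspace_euclidean_subtopology
    by (intro conjI cover ballI inf fin countable_subset[OF VU U(3)] subset_trans[OF VU U(4)]
        U(2) subsetD[OF VU])
  with VU show "\<exists>\<V>\<subseteq>\<U>. \<V> \<in> borel_gamma_covers (top_of_set (cantor ` X))" by blast
qed

section \<open>Failure of Menger's property for the product\<close>

text \<open>The \<open>n\<close>-th cover sorts pairs by how early \<open>x - z\<close> acquires
  more than \<open>n\<close> elements. Its members form an increasing sequence, so finite selections
  amount to one function \<open>g\<close>, and a pair that is sparse for \<open>g\<close> escapes
  them all.\<close>

lemma not_menger_cantor: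
  assumes inf: "\<And>x z. x \<in> X \<Longrightarrow> z \<in> Z \<Longrightarrow> infinite (x - z)"
    and sparse: "\<And>g. \<exists>x\<in>X. \<exists>z\<in>Z. \<forall>n. card ((x - z) \<inter> {..<g n}) \<le> n"
  shows "\<not> S_fin (open_covers (prod_topology (top_of_set (cantor ` X)) (top_of_set (cantor ` Z))))
            (open_covers (prod_topology (top_of_set (cantor ` X)) (top_of_set (cantor ` Z))))"
proof
  define S where "S = cantor ` X \<times> cantor ` Z"
  have top: "prod_topology (top_of_set (cantor ` X)) (top_of_set (cantor ` Z)) = top_of_set S"
    by (simp add: S_def subtopology_Times[symmetric] euclidean_product_topology)
  assume "S_fin (open_covers (prod_topology (top_of_set (cantor ` X)) (top_of_set (cantor ` Z))))
            (open_covers (prod_topology (top_of_set (cantor ` X)) (top_of_set (cantor ` Z))))"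
  then have SF: "S_fin (open_covers (top_of_set S)) (open_covers (top_of_set S))" by (simp only: top)
  \<comment> \<open>Membership says that the \<open>n\<close>-th element of \<open>x - z\<close>,
    counted from \<open>0\<close>, is below \<open>k\<close>.\<close>
  define V where "V n k = {(cantor x, cantor z) | x z. x \<in> X \<and> z \<in> Z \<and> n < card ((x - z) \<inter> {..<k})}" for n k
  have V_iff: "(cantor x, cantor z) \<in> V n k \<longleftrightarrow> n < card ((x - z) \<inter> {..<k})" if "x \<in> X" "z \<in> Z" for x z n k
    using that inj_cantor by (auto simp: V_def inj_eq)
  have V_sub: "V n k \<subseteq> S" for n k by (auto simp: V_def S_def)
  have V_mono: "V n k \<subseteq> V n l" if "k \<le> l" for n k l
  proof -
    have "card ((x - z) \<inter> {..<k}) \<le> card ((x - z) \<inter> {..<l})" for x z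
      using that by (intro card_mono) auto
    then show ?thesis unfolding V_def by (blast intro: less_le_trans)
  qed
  have V_open: "openin (top_of_set S) (V n k)" for n k
    unfolding openin_euclidean_subtopology_iff
  proof (intro conjI ballI V_sub)
    fix w assume "w \<in> V n k"
    then obtain x z where w: "w = (cantor x, cantor z)" "x \<in> X" "z \<in> Z" "n < card ((x - z) \<inter> {..<k})"
      by (auto simp: V_def)
    \<comment> \<open>Within this radius both coordinates keep their traces below \<open>k\<close>,
      which determine membership in \<open>V n k\<close>.\<close>
    have "w' \<in> V n k" if w': "w' \<in> S" "dist w' w < (1/3) ^ k / 2" for w'
    proof -
      obtain x' z' where x': "w' = (cantor x', cantor z')" "x' \<in> X" "z' \<in> Z" using w'(1) by (auto simp: S_def)
      have "dist (cantor x') (cantor x) < (1/3) ^ k / 2" "dist (cantor z') (cantor z) < (1/3) ^ k / 2"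
        using dist_fst_le[of w' w] dist_snd_le[of w' w] w'(2) x'(1) w(1) by auto
      then have "agree k x' x" "agree k z' z" by (auto intro: cantor_close simp: dist_real_def)
      then have "(x' - z') \<inter> {..<k} = (x - z) \<inter> {..<k}" by (auto simp: agree_def)
      then show ?thesis using V_iff x' w(4) by simp
    qed
    then show "\<exists>e>0. \<forall>w'\<in>S. dist w' w < e \<longrightarrow> w' \<in> V n k"
      by (intro exI[of _ "(1/3) ^ k / 2"]) simp
  qed
  have "range (V n) \<in> open_covers (top_of_set S)" for n
  proof -
    have "S \<subseteq> (\<Union>k. V n k)"
    proof
      fix w assume "w \<in> S"
      then obtain x z where w: "w = (cantor x, cantor z)" "x \<in> X" "z \<in> Z" by (auto simp: S_def)
      obtain T where T: "finite T" "card T = Suc n" "T \<subseteq> x - z"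
        using infinite_arbitrarily_large[OF inf[OF w(2,3)]] by blast
      then obtain k where k: "T \<subseteq> {..<k}" using finite_nat_iff_bounded by blast
      have "card T \<le> card ((x - z) \<inter> {..<k})" using T k by (intro card_mono) auto
      then have "w \<in> V n k" using V_iff w T(2) by simp
      then show "w \<in> (\<Union>k. V n k)" by blast
    qed
    moreover have "\<not> S \<subseteq> V n k" for k
    proof
      assume S: "S \<subseteq> V n k"
      \<comment> \<open>Sparseness for the constant function with value \<open>k\<close> gives a
        pair outside \<open>V n k\<close>, so the cover is proper.\<close>
      obtain x z where xz: "x \<in> X" "z \<in> Z" "\<forall>i. card ((x - z) \<inter> {..<k}) \<le> i" using sparse[of "\<lambda>_. k"] by blast
      then have "(cantor x, cantor z) \<in> V n k" using S by (auto simp: S_def)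
      then show False using V_iff xz by (metis not_less)
    qed
    moreover have "(\<Union>k. V n k) \<subseteq> S" using V_sub by blast
    ultimately have "S = (\<Union>k. V n k)" "\<forall>U\<in>range (V n). \<not> S \<subseteq> U" by blast+
    then show ?thesis using V_open
      unfolding open_covers_def is_cover_def mem_Collect_eq topspace_euclidean_subtopology by blast
  qed
  then obtain \<F> where F: "\<And>n. finite (\<F> n) \<and> \<F> n \<subseteq> range (V n)" "(\<Union>n. \<F> n) \<in> open_covers (top_of_set S)"
    using SF[unfolded S_fin_def, rule_format, of "\<lambda>n. range (V n)"] by blast
  have "\<exists>k. \<Union>(\<F> n) \<subseteq> V n k" for n
  proof -
    obtain K where K: "finite K" "\<F> n = V n ` K" using F(1)[of n] finite_subset_image by metis
    then obtain k where "K \<subseteq> {..<k}" using finite_nat_iff_bounded by blast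
    then have "V n j \<subseteq> V n k" if "j \<in> K" for j using V_mono that by (meson lessThan_iff less_imp_le subsetD)
    then have "\<Union>(\<F> n) \<subseteq> V n k" unfolding K(2) by (rule UN_least)
    then show ?thesis ..
  qed
  then obtain g where g: "\<And>n. \<Union>(\<F> n) \<subseteq> V n (g n)" by metis
  obtain x z where xz: "x \<in> X" "z \<in> Z" "\<And>n. card ((x - z) \<inter> {..<g n}) \<le> n" using sparse[of g] by blast
  have "(cantor x, cantor z) \<in> S" using xz by (auto simp: S_def)
  moreover have "S = \<Union>(\<Union>n. \<F> n)" using F(2) by (simp add: open_covers_def is_cover_def)
  ultimately obtain n where "(cantor x, cantor z) \<in> \<Union>(\<F> n)" by auto
  then have "n < card ((x - z) \<inter> {..<g n})" using g[of n] V_iff[OF xz(1,2)] by blast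
  then show False using xz(3)[of n] by simp
qed

section \<open>Ordering the tasks under the Continuum Hypothesis\<close>

text \<open>A task is recovered from its graph, a subset of a countable set, and
  \<open>cantor\<close> maps sets of natural numbers injectively into the reals.\<close>

lemma task_le_real: "|UNIV :: task set| \<le>o |UNIV :: real set|"
proof -
  have "inj (\<lambda>t :: task. cantor (to_nat ` range (\<lambda>u. (u, t u))))"
  proof (rule injI)
    fix t t' :: task
    assume "cantor (to_nat ` range (\<lambda>u. (u, t u))) = cantor (to_nat ` range (\<lambda>u. (u, t' u)))"
    then have "to_nat ` range (\<lambda>u. (u, t u)) = to_nat ` range (\<lambda>u. (u, t' u))"
      by (rule injD[OF inj_cantor])
    then have "range (\<lambda>u. (u, t u)) = range (\<lambda>u. (u, t' u))"
      by (simp only: inj_image_eq_iff[OF inj_to_nat])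
    then have "(u, t u) \<in> range (\<lambda>u. (u, t' u))" for u by blast
    then have "t u = t' u" for u by blast
    then show "t = t'" by (rule ext)
  qed
  then show ?thesis unfolding card_of_ordLeq[symmetric] by blast
qed

text \<open>In the cardinal order of the tasks a proper initial segment has smaller cardinality than
  the whole, hence smaller than the successor of \<open>natLeq\<close>, so it is countable.\<close>

lemma continuum_hypothesis_order:
  assumes continuum_hypothesis
  obtains r :: "(task \<times> task) set" where "wf r" "trans r"
    "\<And>s t. s = t \<or> (s, t) \<in> r \<or> (t, s) \<in> r" "\<And>t. countable {s. (s, t) \<in> r}"
proof -
  define r0 where "r0 = |UNIV :: task set|"
  have wo: "well_order r0" unfolding r0_def by (rule card_of_well_order_on)
  have "r0 \<le>o cardSuc natLeq"
    using task_le_real assms unfolding r0_def continuum_hypothesis_def by (rule ordLeq_ordIso_trans)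
  have "countable {s. (s, t) \<in> r0 - Id}" for t
  proof -
    have "|underS r0 t| <o r0"
      unfolding r0_def by (rule card_of_underS[OF card_of_Card_order]) (simp add: Field_card_of)
    then have "|underS r0 t| <o cardSuc natLeq" using \<open>r0 \<le>o cardSuc natLeq\<close> by (rule ordLess_ordLeq_trans)
    then have "|underS r0 t| \<le>o natLeq"
      by (simp add: cardSuc_ordLeq_ordLess natLeq_Card_order card_of_Card_order)
    then have "|underS r0 t| \<le>o |UNIV :: nat set|"
      using ordIso_symmetric[OF card_of_nat] by (rule ordLeq_ordIso_trans)
    then obtain f :: "task \<Rightarrow> nat" where "inj_on f (underS r0 t)"
      unfolding card_of_ordLeq[symmetric] by blast
    then have "countable (underS r0 t)" by (rule countableI)
    moreover have "{s. (s, t) \<in> r0 - Id} = underS r0 t" by (auto simp: underS_def)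
    ultimately show ?thesis by simp
  qed
  moreover have "wf (r0 - Id)" using wo by (simp add: well_order_on_def)
  moreover have "trans (r0 - Id)"
    using wo by (auto simp: well_order_on_def linear_order_on_def partial_order_on_def preorder_on_def
        intro: trans_diff_Id)
  moreover have "s = t \<or> (s, t) \<in> r0 - Id \<or> (t, s) \<in> r0 - Id" for s t
    using wo by (auto simp: well_order_on_def linear_order_on_def total_on_def)
  ultimately show thesis using that by blast
qed

theorem theorem3p2:
  assumes "continuum_hypothesis"
  shows "\<exists>(X :: real set) (Y :: real set).
    choose_property (borel_omega_covers (top_of_set X)) (borel_gamma_covers (top_of_set X)) \<and>
    choose_property (borel_omega_covers (top_of_set Y)) (borel_gamma_covers (top_of_set Y)) \<and>
    \<not> S_fin (open_covers (prod_topology (top_of_set X) (top_of_set Y)))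
            (open_covers (prod_topology (top_of_set X) (top_of_set Y)))"
proof -
  obtain r :: "(task \<times> task) set" where r: "wf r" "trans r"
    "\<And>s t. s = t \<or> (s, t) \<in> r \<or> (t, s) \<in> r" "\<And>t. countable {s. (s, t) \<in> r}"
    by (rule continuum_hypothesis_order[OF assms]) (rule that; assumption)
  obtain X Z where XZ: "\<And>x z. x \<in> X \<Longrightarrow> z \<in> Z \<Longrightarrow> infinite (x - z)"
    "\<And>g. \<exists>x\<in>X. \<exists>z\<in>Z. \<forall>n. card ((x - z) \<inter> {..<g n}) \<le> n"
    "\<And>B. \<forall>i. coded (B i) \<Longrightarrow> selectable B X X"
    "\<And>B. \<forall>i. coded (B i) \<Longrightarrow> selectable B Z Z"
    by (rule nat_set_families[OF r]) (rule that; assumption)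
  show ?thesis
    using choose_property_cantor[OF XZ(3)] choose_property_cantor[OF XZ(4)] not_menger_cantor[OF XZ(1,2)]
    by blast
qed

end
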